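(* Let $p$ be a prime number. The $p$-typical Witt vectors $W_{(p)}(\mathbb{B})$ of the Boolean semiring are canonically isomorphic to $\mathbb{N}^2\cup\{\infty\}$ as a partially ordered set, via the map sending $(x,y)\in\mathbb{N}^2$ to the Witt vector $a$ with $a(d_{i,j})=0\Leftrightarrow(i\ge x\text{ and }j\ge y)$, and sending $\infty$ to the Witt vector $a$ with $a(d_{i,j})=1$ for all $i,j\in\mathbb{N}$. With respect to this identification, the semiring structure on $W_{(p)}(\mathbb{B})$ is independent of $p$, for $p>2$.
   Context: $\mathbb{N}=\{0,1,\dots\}$; semirings are commutative with $0,1$, homomorphisms preserve $0,1$; $\mathbb{B}=\{0,1\}$ with $1+1=1$ and $0<1$. $\mathbb{N}^2\cup\{\infty\}$ has the componentwise order on $\mathbb{N}^2$, with $\infty$ as largest element. Let $\Lambda_{\mathbb{N}}=\bigoplus_\lambda\mathbb{N}m_\lambda$ be the semiring of symmetric functions in $x_1,x_2,\dots$ with coefficients in $\mathbb{N}$ (with $m_\lambda$ the monomial symmetric functions), a subsemiring of the ring $\Lambda_{\mathbb{Z}}$ of symmetric functions. Let $\psi=\sum_ix_i^p$, $d=\frac{(\sum_ix_i)^p-\sum_ix_i^p}{p}$, and $d_{i,j}=d^{\circ i}\circ\psi^{\circ j}\in\Lambda_{\mathbb{N}}$ for $i,j\in\mathbb{N}$, where $\circ$ is plethysm (so $d_{0,0}=\sum_i x_i$). Let $\Lambda_{\mathbb{N},(p)}\subseteq\Lambda_{\mathbb{N}}$ be the subsemiring generated by all $d_{i,j}$; the relations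 among the $d_{i,j}$ are generated by $d_{i,j}^p=p\,d_{i+1,j}+d_{i,j+1}$. For a semiring $A$, $W_{(p)}(A)=\mathrm{Hom}_{\mathrm{semiring}}(\Lambda_{\mathbb{N},(p)},A)$. Semiring structure on $W_{(p)}(A)$: the maps $\Delta^+:f(\dots,x_i,\dots)\mapsto f(\dots,x_i\otimes1,1\otimes x_i,\dots)$ and $\Delta^\times:f(\dots,x_i,\dots)\mapsto f(\dots,x_i\otimes x_j,\dots)$ restrict to semiring maps $\Lambda_{\mathbb{N},(p)}\to\Lambda_{\mathbb{N},(p)}\otimes_{\mathbb{N}}\Lambda_{\mathbb{N},(p)}$ (the target being viewed inside $\Lambda_{\mathbb{Z}}\otimes\Lambda_{\mathbb{Z}}$). Then $a+b$ and $ab$ are the composites of $\Delta^+$ and $\Delta^\times$ with $f\otimes g\mapsto a(f)b(g)$; the elements $0,1$ are $f\mapsto f(0,0,\dots)$ and $f\mapsto f(1,0,0,\dots)$ (images in $A$). The partial order on $W_{(p)}(\mathbb{B})$ is $a\preccurlyeq b$ iff $a(f)\le b(f)$ for all $f\in\Lambda_{\mathbb{N},(p)}$. *)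

theory Defs
  imports
    "HOL-Library.Multiset"
    "HOL-Library.FuncSet"
    "HOL-Library.Nat_Bijection"
    "HOL-Computational_Algebra.Primes"
begin

section \<open>Formal power series in a set of variables\<close>

text \<open>
  A monomial in the variables \<open>'v\<close> is the finite multiset of its variables: the product of
  monomials is \<open>+\<close> on multisets, the monomial 1 is the empty multiset, and the degree is
  \<^const>\<open>size\<close>. An element of \<open>'v mps\<close> is a formal, possibly infinite, sum of monomials
  with integer coefficients.
\<close>

typedef 'v mps = "UNIV :: ('v multiset \<Rightarrow> int) set"
  morphisms coeff Mps ..

lemma coeff_Mps [simp]: "coeff (Mps f) = f"
  by (simp add: Mps_inverse)

lemma mps_eqI: "(\<And>m. coeff f m = coeff g m) \<Longrightarrow> f = g"
  by (metis coeff_inject ext)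

lemma finite_submultisets: "finite {a. a \<subseteq># m}"
proof (induction m)
  case (add x m)
  have "{a. a \<subseteq># add_mset x m} \<subseteq> {a. a \<subseteq># m} \<union> add_mset x ` {a. a \<subseteq># m}"
  proof
    fix a assume a: "a \<in> {a. a \<subseteq># add_mset x m}"
    show "a \<in> {a. a \<subseteq># m} \<union> add_mset x ` {a. a \<subseteq># m}"
    proof (cases "x \<in># a")
      case True
      then obtain b where "a = add_mset x b"
        by (meson mset_add)
      with a show ?thesis
        by auto
    next
      case False
      then have "count a y \<le> count m y" for y
        using a by (cases "y = x") (auto simp: subseteq_mset_def not_in_iff dest: spec[of _ y])
      then show ?thesis
        by (simp add: subseteq_mset_def)
    qed
  qed
  then show ?case
    using add finite_subset by blast
qed simp

instantiation mps :: (type) comm_ring_1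
begin

definition "0 = Mps (\<lambda>_. 0)"
definition "1 = Mps (\<lambda>m. if m = {#} then 1 else 0)"
definition "f + g = Mps (\<lambda>m. coeff f m + coeff g m)"
definition "- f = Mps (\<lambda>m. - coeff f m)"
definition "f - g = Mps (\<lambda>m. coeff f m - coeff g m)"
definition "f * g = Mps (\<lambda>m. \<Sum>a | a \<subseteq># m. coeff f a * coeff g (m - a))"

instance
proof
  fix f g h :: "'a mps"
  show "f * g * h = f * (g * h)"
  proof (rule mps_eqI)
    fix m :: "'a multiset"
    have A: "a - b \<subseteq># m - b" "b \<subseteq># m" "b + (a - b) = a" "m - b - (a - b) = m - a"
      if "a \<subseteq># m" "b \<subseteq># a" for a b
    proof -
      show "b + (a - b) = a"
        using that by simp
      then show "m - b - (a - b) = m - a"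
        by (metis diff_diff_add_mset)
    qed (use that in \<open>auto simp: subseteq_mset_def intro: le_trans diff_le_mono\<close>)
    have B: "b + c \<subseteq># m" if "b \<subseteq># m" "c \<subseteq># m - b" for b c
      using that by (simp add: subset_mset.le_diff_conv2 add.commute)
    have "coeff (f * g * h) m =
        (\<Sum>(a, b)\<in>(SIGMA a:{a. a \<subseteq># m}. {b. b \<subseteq># a}).
          coeff f b * coeff g (a - b) * coeff h (m - a))"
      by (simp add: times_mps_def sum_distrib_right sum.Sigma finite_submultisets)
    also have "\<dots> = (\<Sum>(b, c)\<in>(SIGMA b:{b. b \<subseteq># m}. {c. c \<subseteq># m - b}).
          coeff f b * (coeff g c * coeff h (m - b - c)))"
      by (rule sum.reindex_bij_witness[where i = "\<lambda>(b, c). (b + c, b)" and j = "\<lambda>(a, b). (b, a - b)"])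
        (auto simp: A B mult.assoc)
    also have "\<dots> = coeff (f * (g * h)) m"
      by (simp add: times_mps_def sum_distrib_left sum.Sigma finite_submultisets)
    finally show "coeff (f * g * h) m = coeff (f * (g * h)) m" .
  qed
  show "f * g = g * f"
  proof (rule mps_eqI)
    fix m :: "'a multiset"
    have C: "m - (m - a) = a" if "a \<subseteq># m" for a
      using that by (simp add: multiset_eq_iff subseteq_mset_def)
    have "(\<Sum>a | a \<subseteq># m. coeff f a * coeff g (m - a)) = (\<Sum>a | a \<subseteq># m. coeff g a * coeff f (m - a))"
      by (rule sum.reindex_bij_witness[where i = "\<lambda>a. m - a" and j = "\<lambda>a. m - a"])
        (auto simp: C mult.commute)
    then show "coeff (f * g) m = coeff (g * f) m"
      by (simp add: times_mps_def)
  qed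
  show "1 * f = f"
  proof (rule mps_eqI)
    fix m :: "'a multiset"
    have "coeff (1 * f) m = (\<Sum>a | a \<subseteq># m. if a = {#} then coeff f m else 0)"
      unfolding times_mps_def one_mps_def coeff_Mps by (rule sum.cong) auto
    also have "\<dots> = coeff f m"
      by (simp add: finite_submultisets)
    finally show "coeff (1 * f) m = coeff f m" .
  qed
  show "(f + g) * h = f * h + g * h"
    by (rule mps_eqI) (simp add: times_mps_def plus_mps_def distrib_right sum.distrib)
  show "(0 :: 'a mps) \<noteq> 1"
    using coeff_Mps[of "\<lambda>_. 0"] by (auto simp: zero_mps_def one_mps_def Mps_inject fun_eq_iff)
  show "f + g + h = f + (g + h)" "f + g = g + f" "0 + f = f" "- f + f = 0" "f - g = f + - g"
    by (rule mps_eqI, simp add: plus_mps_def zero_mps_def uminus_mps_def minus_mps_def)+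
qed

end

text \<open>
  The result \<open>f(y 0, y 1, \<dots>)\<close> of substituting for every variable either a monomial or (\<^const>\<open>None\<close>)
  zero. The sums below are finite whenever \<open>f\<close> has bounded degree and every monomial is
  substituted for only finitely many variables; only such instances are used.
\<close>

definition msubst :: "('v \<Rightarrow> 'w multiset option) \<Rightarrow> 'v mps \<Rightarrow> 'w mps" where
  "msubst y f = Mps (\<lambda>m.
     \<Sum>a | coeff f a \<noteq> 0 \<and> None \<notin> y ` set_mset a \<and> (\<Sum>i\<in>#a. the (y i)) = m. coeff f a)"


section \<open>Symmetric functions\<close>

definition symmetric :: "'v mps \<Rightarrow> bool" where
  "symmetric f \<longleftrightarrow> (\<forall>\<sigma> m. bij \<sigma> \<longrightarrow> coeff f (image_mset \<sigma> m) = coeff f m)"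

definition bounded_degree :: "'v mps \<Rightarrow> bool" where
  "bounded_degree f \<longleftrightarrow> (\<exists>n. \<forall>m. coeff f m \<noteq> 0 \<longrightarrow> size m \<le> n)"

definition Lambda_Z :: "nat mps set" where
  "Lambda_Z = {f. symmetric f \<and> bounded_degree f}"

definition Lambda_N :: "nat mps set" where
  "Lambda_N = {f \<in> Lambda_Z. \<forall>m. coeff f m \<ge> 0}"

text \<open>
  Plethysm \<open>f \<circ> g\<close> for \<open>g\<close> in \<^const>\<open>Lambda_N\<close>: write \<open>g\<close> as a sum \<open>y 0 + y 1 + \<dots>\<close> of
  monomials with coefficient 1 (each monomial occurring as often as its coefficient says, padded
  with zeros) and substitute them for the variables of \<open>f\<close>. As \<open>f\<close> is symmetric, the order of
  the \<open>y i\<close> does not matter.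
\<close>

definition monomial_enumeration :: "nat mps \<Rightarrow> (nat \<Rightarrow> nat multiset option) \<Rightarrow> bool" where
  "monomial_enumeration g y \<longleftrightarrow>
     (\<forall>m. finite {i. y i = Some m} \<and> int (card {i. y i = Some m}) = coeff g m)"

definition plethysm :: "nat mps \<Rightarrow> nat mps \<Rightarrow> nat mps" where
  "plethysm f g = msubst (SOME y. monomial_enumeration g y) f"

definition power_sum :: "nat \<Rightarrow> nat mps" where
  "power_sum n = Mps (\<lambda>m. if \<exists>i. m = replicate_mset n i then 1 else 0)"

definition psi :: "nat \<Rightarrow> nat mps" where
  "psi p = power_sum p"

text \<open>The division by \<open>p\<close> is exact for prime \<open>p\<close>.\<close>

definition delta :: "nat \<Rightarrow> nat mps" where
  "delta p = Mps (\<lambda>m. coeff (power_sum 1 ^ p - power_sum p) m div int p)"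

definition plethysm_power :: "nat mps \<Rightarrow> nat \<Rightarrow> nat mps" where
  "plethysm_power f n = (plethysm f ^^ n) (power_sum 1)"

definition d :: "nat \<Rightarrow> nat \<Rightarrow> nat \<Rightarrow> nat mps" where
  "d p i j = plethysm (plethysm_power (delta p) i) (plethysm_power (psi p) j)"

inductive_set subsemiring_generated :: "'a::comm_semiring_1 set \<Rightarrow> 'a set" for X where
  zero: "0 \<in> subsemiring_generated X"
| one: "1 \<in> subsemiring_generated X"
| incl: "x \<in> X \<Longrightarrow> x \<in> subsemiring_generated X"
| add: "x \<in> subsemiring_generated X \<Longrightarrow> y \<in> subsemiring_generated X \<Longrightarrow> x + y \<in> subsemiring_generated X"
| mult: "x \<in> subsemiring_generated X \<Longrightarrow> y \<in> subsemiring_generated X \<Longrightarrow> x * y \<in> subsemiring_generated X"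

definition Lambda_typ :: "nat \<Rightarrow> nat mps set" where
  "Lambda_typ p = subsemiring_generated {d p i j | i j. True}"


subsection \<open>The generated semiring consists of symmetric functions\<close>

lemma Lambda_N_I:
  assumes "\<And>\<sigma> m. bij \<sigma> \<Longrightarrow> coeff f (image_mset \<sigma> m) = coeff f m"
    and "\<And>m. coeff f m \<noteq> 0 \<Longrightarrow> size m \<le> n" and "\<And>m. coeff f m \<ge> 0"
  shows "f \<in> Lambda_N"
  using assms unfolding Lambda_N_def Lambda_Z_def symmetric_def bounded_degree_def by blast

lemma Lambda_N_E:
  assumes "f \<in> Lambda_N"
  obtains n where "\<And>\<sigma> m. bij \<sigma> \<Longrightarrow> coeff f (image_mset \<sigma> m) = coeff f m"
    and "\<And>m. coeff f m \<noteq> 0 \<Longrightarrow> size m \<le> n" and "\<And>m. coeff f m \<ge> 0"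
  using assms unfolding Lambda_N_def Lambda_Z_def symmetric_def bounded_degree_def by blast

lemma image_mset_bij_inv:
  assumes "bij \<sigma>"
  shows "image_mset \<sigma> (image_mset (inv \<sigma>) a) = a" "image_mset (inv \<sigma>) (image_mset \<sigma> a) = a"
  using assms by (simp_all add: multiset.map_comp o_def surj_f_inv_f bij_is_surj inv_f_f bij_is_inj)

lemma image_mset_bij_eq_iff:
  assumes "bij (\<sigma> :: 'a \<Rightarrow> 'a)"
  shows "image_mset \<sigma> a = image_mset \<sigma> b \<longleftrightarrow> a = b"
proof
  assume "image_mset \<sigma> a = image_mset \<sigma> b"
  then have "image_mset (inv \<sigma>) (image_mset \<sigma> a) = image_mset (inv \<sigma>) (image_mset \<sigma> b)"
    by (rule arg_cong)
  then show "a = b"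
    by (simp only: image_mset_bij_inv[OF assms])
qed simp

lemma Lambda_N_zero: "0 \<in> Lambda_N"
  by (rule Lambda_N_I[where n = 0]) (simp_all add: zero_mps_def)

lemma Lambda_N_one: "1 \<in> Lambda_N"
  by (rule Lambda_N_I[where n = 0]) (auto simp: one_mps_def split: if_splits)

lemma Lambda_N_add:
  assumes "f \<in> Lambda_N" "g \<in> Lambda_N"
  shows "f + g \<in> Lambda_N"
proof -
  obtain n k where f: "\<And>\<sigma> m. bij \<sigma> \<Longrightarrow> coeff f (image_mset \<sigma> m) = coeff f m"
      "\<And>m. coeff f m \<noteq> 0 \<Longrightarrow> size m \<le> n" "\<And>m. coeff f m \<ge> 0"
    and g: "\<And>\<sigma> m. bij \<sigma> \<Longrightarrow> coeff g (image_mset \<sigma> m) = coeff g m"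
      "\<And>m. coeff g m \<noteq> 0 \<Longrightarrow> size m \<le> k" "\<And>m. coeff g m \<ge> 0"
    using assms by (metis Lambda_N_E)
  show ?thesis
  proof (rule Lambda_N_I[where n = "max n k"])
    show "size m \<le> max n k" if "coeff (f + g) m \<noteq> 0" for m
      using that f(2)[of m] g(2)[of m] by (cases "coeff f m = 0") (auto simp: plus_mps_def)
  qed (simp_all add: plus_mps_def f g)
qed

lemma Lambda_N_mult:
  assumes "f \<in> Lambda_N" "g \<in> Lambda_N"
  shows "f * g \<in> Lambda_N"
proof -
  obtain n k where f: "\<And>\<sigma> m. bij \<sigma> \<Longrightarrow> coeff f (image_mset \<sigma> m) = coeff f m"
      "\<And>m. coeff f m \<noteq> 0 \<Longrightarrow> size m \<le> n" "\<And>m. coeff f m \<ge> 0"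
    and g: "\<And>\<sigma> m. bij \<sigma> \<Longrightarrow> coeff g (image_mset \<sigma> m) = coeff g m"
      "\<And>m. coeff g m \<noteq> 0 \<Longrightarrow> size m \<le> k" "\<And>m. coeff g m \<ge> 0"
    using assms by (metis Lambda_N_E)
  show ?thesis
  proof (rule Lambda_N_I[where n = "n + k"])
    fix \<sigma> :: "nat \<Rightarrow> nat" and m assume \<sigma>: "bij \<sigma>"
    have diff: "image_mset \<sigma> m - image_mset \<sigma> a = image_mset \<sigma> (m - a)" if "a \<subseteq># m" for a
      using that by (simp add: image_mset_Diff)
    have "(\<Sum>a | a \<subseteq># image_mset \<sigma> m. coeff f a * coeff g (image_mset \<sigma> m - a)) =
        (\<Sum>a | a \<subseteq># m. coeff f a * coeff g (m - a))"
    proof (rule sum.reindex_bij_witness[where i = "image_mset \<sigma>" and j = "image_mset (inv \<sigma>)"])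
      fix a assume "a \<in> {a. a \<subseteq># image_mset \<sigma> m}"
      then have "image_mset (inv \<sigma>) a \<subseteq># image_mset (inv \<sigma>) (image_mset \<sigma> m)"
        using image_mset_subseteq_mono by blast
      then have a: "image_mset (inv \<sigma>) a \<subseteq># m"
        by (simp only: image_mset_bij_inv[OF \<sigma>])
      then show "image_mset (inv \<sigma>) a \<in> {a. a \<subseteq># m}"
        by simp
      show "coeff f (image_mset (inv \<sigma>) a) * coeff g (m - image_mset (inv \<sigma>) a) =
          coeff f a * coeff g (image_mset \<sigma> m - a)"
        using diff[OF a] f(1)[OF \<sigma>] g(1)[OF \<sigma>] by (metis image_mset_bij_inv(1)[OF \<sigma>])
    qed (use image_mset_subseteq_mono in \<open>auto simp only: image_mset_bij_inv[OF \<sigma>]\<close>)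
    then show "coeff (f * g) (image_mset \<sigma> m) = coeff (f * g) m"
      by (simp add: times_mps_def)
  next
    fix m assume "coeff (f * g) m \<noteq> 0"
    then obtain a where a: "a \<subseteq># m" "coeff f a * coeff g (m - a) \<noteq> 0"
      by (auto simp: times_mps_def elim: sum.not_neutral_contains_not_neutral)
    then have "size a + size (m - a) \<le> n + k"
      by (intro add_mono f(2) g(2)) auto
    then show "size m \<le> n + k"
      using a(1) by (simp add: size_Diff_submset)
  qed (auto simp: times_mps_def f g intro!: sum_nonneg)
qed

lemma Lambda_N_power: "f \<in> Lambda_N \<Longrightarrow> f ^ n \<in> Lambda_N"
  by (induction n) (auto intro: Lambda_N_one Lambda_N_mult)

lemma Lambda_N_power_sum: "power_sum n \<in> Lambda_N"
proof (rule Lambda_N_I[where n = n])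
  fix \<sigma> :: "nat \<Rightarrow> nat" and m assume \<sigma>: "bij \<sigma>"
  have "(\<exists>i. image_mset \<sigma> m = replicate_mset n i) \<longleftrightarrow> (\<exists>i. m = replicate_mset n i)"
    by (metis image_mset_bij_inv(2)[OF \<sigma>] image_replicate_mset)
  then show "coeff (power_sum n) (image_mset \<sigma> m) = coeff (power_sum n) m"
    by (simp add: power_sum_def)
qed (auto simp: power_sum_def split: if_splits)

lemma coeff_power_sum_power_pos: "coeff (power_sum 1 ^ n) (replicate_mset n i) \<ge> 1"
proof (induction n)
  case (Suc n)
  let ?m = "replicate_mset (Suc n) i"
  let ?t = "\<lambda>a. coeff (power_sum 1) a * coeff (power_sum 1 ^ n) (?m - a)"
  have "?t {#i#} \<le> (\<Sum>a | a \<subseteq># ?m. ?t a)"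
  proof (rule member_le_sum)
    show "0 \<le> ?t a" for a
      using Lambda_N_power[OF Lambda_N_power_sum] Lambda_N_power_sum
      by (meson Lambda_N_E mult_nonneg_nonneg)
  qed (auto simp: finite_submultisets)
  then show ?case
    using Suc by (auto simp: times_mps_def power_sum_def)
qed (simp add: one_mps_def)

lemma Lambda_N_delta: "delta p \<in> Lambda_N"
proof -
  let ?e = "power_sum 1 ^ p"
  obtain n where e: "\<And>\<sigma> m. bij \<sigma> \<Longrightarrow> coeff ?e (image_mset \<sigma> m) = coeff ?e m"
      "\<And>m. coeff ?e m \<noteq> 0 \<Longrightarrow> size m \<le> n" "\<And>m. coeff ?e m \<ge> 0"
    using Lambda_N_power[OF Lambda_N_power_sum] by (metis Lambda_N_E)
  obtain k where q: "\<And>\<sigma> m. bij \<sigma> \<Longrightarrow> coeff (power_sum p) (image_mset \<sigma> m) = coeff (power_sum p) m"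
      "\<And>m. coeff (power_sum p) m \<noteq> 0 \<Longrightarrow> size m \<le> k"
    using Lambda_N_power_sum by (metis Lambda_N_E)
  have c: "coeff (delta p) m = (coeff ?e m - coeff (power_sum p) m) div int p" for m
    by (simp add: delta_def minus_mps_def)
  show ?thesis
  proof (rule Lambda_N_I[where n = "max n k"])
    show "size m \<le> max n k" if "coeff (delta p) m \<noteq> 0" for m
      using that e(2)[of m] q(2)[of m]
      by (cases "coeff ?e m = 0"; cases "coeff (power_sum p) m = 0") (auto simp: c)
    show "coeff (delta p) m \<ge> 0" for m
    proof -
      have "coeff (power_sum p) m \<le> coeff ?e m"
        using e(3)[of m] coeff_power_sum_power_pos[of p] by (auto simp: power_sum_def[of p])
      then show ?thesis
        by (cases "p > 0") (simp_all add: delta_def minus_mps_def pos_imp_zdiv_nonneg_iff)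
    qed
  qed (simp add: c e(1) q(1) del: One_nat_def)
qed

lemma monomial_enumeration_exists:
  assumes "g \<in> Lambda_N"
  shows "\<exists>y. monomial_enumeration g y"
proof -
  define code where "code = (\<lambda>(m :: nat multiset, k :: nat).
    prod_encode (list_encode (sorted_list_of_multiset m), k))"
  have inj: "inj code"
    by (rule injI) (auto simp: code_def list_encode_eq prod_encode_eq
        dest!: arg_cong[where f = mset and x = "sorted_list_of_multiset _"])
  define I where "I = {(m, k). int k < coeff g m}"
  define y where "y = (\<lambda>i. if i \<in> code ` I then Some (fst (inv code i)) else None)"
  have "{i. y i = Some m} = (\<lambda>k. code (m, k)) ` {..<nat (coeff g m)}" for m
    by (auto simp: y_def I_def inv_f_f[OF inj] inj_eq[OF inj] image_iff)
  moreover have "inj_on (\<lambda>k. code (m, k)) A" for m A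
    using inj by (auto simp: inj_on_def)
  moreover have "coeff g m \<ge> 0" for m
    using assms by (meson Lambda_N_E)
  ultimately have "monomial_enumeration g y"
    by (simp add: monomial_enumeration_def card_image)
  then show ?thesis
    by blast
qed

lemma enumeration_permute:
  assumes y: "monomial_enumeration g y" and g: "g \<in> Lambda_N" and \<sigma>: "bij \<sigma>"
  obtains \<tau> where "bij \<tau>" and "\<And>i. y (\<tau> i) = map_option (image_mset \<sigma>) (y i)"
proof -
  define z where "z = (\<lambda>i. map_option (image_mset \<sigma>) (y i))"
  have "\<exists>h. bij_betw h {i. z i = v} {i. y i = v}" for v
  proof (cases v)
    case None
    then have "{i. z i = v} = {i. y i = v}"
      by (auto simp: z_def)
    then show ?thesis
      by (metis bij_betw_id)
  next
    case (Some m)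
    let ?m = "image_mset (inv \<sigma>) m"
    have "z i = Some m \<longleftrightarrow> y i = Some ?m" for i
      unfolding z_def using image_mset_bij_inv[OF \<sigma>] by (cases "y i") auto
    then have *: "{i. z i = v} = {i. y i = Some ?m}"
      using Some by auto
    have "coeff g ?m = coeff g m"
      using g \<sigma> by (metis Lambda_N_E bij_imp_bij_inv)
    moreover have "int (card {i. y i = Some m'}) = coeff g m'" "finite {i. y i = Some m'}" for m'
      using y unfolding monomial_enumeration_def by blast+
    ultimately show ?thesis
      unfolding * unfolding Some by (intro finite_same_card_bij) (simp_all flip: of_nat_eq_iff[where ?'a = int])
  qed
  then obtain h where h: "\<And>v. bij_betw (h v) {i. z i = v} {i. y i = v}"
    by metis
  define \<tau> where "\<tau> = (\<lambda>i. h (z i) i)"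
  have y\<tau>: "y (\<tau> i) = z i" for i
    using h[of "z i"] by (auto simp: \<tau>_def bij_betw_def)
  have "inj \<tau>"
  proof (rule injI)
    fix i j assume "\<tau> i = \<tau> j"
    then show "i = j"
      using y\<tau>[of i] y\<tau>[of j] h[of "z i"] by (auto simp: \<tau>_def bij_betw_def inj_on_def)
  qed
  moreover have "surj \<tau>"
    unfolding surj_def
  proof
    fix j
    have "j \<in> h (y j) ` {i. z i = y j}"
      using bij_betw_imp_surj_on[OF h[of "y j"]] by simp
    then obtain i where "z i = y j" "h (y j) i = j"
      by auto
    then show "\<exists>i. j = \<tau> i"
      by (intro exI[of _ i]) (simp add: \<tau>_def)
  qed
  ultimately show ?thesis
    using that y\<tau> by (auto simp: bij_def z_def)
qed

lemma Lambda_N_plethysm: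
  assumes f: "f \<in> Lambda_N" and g: "g \<in> Lambda_N"
  shows "plethysm f g \<in> Lambda_N"
proof -
  define y where "y = (SOME y. monomial_enumeration g y)"
  have y: "monomial_enumeration g y"
    unfolding y_def using monomial_enumeration_exists[OF g] by (rule someI_ex)
  define A where
    "A = (\<lambda>m. {a. coeff f a \<noteq> 0 \<and> None \<notin> y ` set_mset a \<and> (\<Sum>i\<in>#a. the (y i)) = m})"
  have c: "coeff (plethysm f g) m = (\<Sum>a\<in>A m. coeff f a)" for m
    by (simp add: plethysm_def msubst_def A_def y_def)
  obtain n where n: "\<And>m. coeff f m \<noteq> 0 \<Longrightarrow> size m \<le> n"
    using f by (metis Lambda_N_E)
  have f_inv: "coeff f (image_mset \<tau> a) = coeff f a" if "bij \<tau>" for \<tau> a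
    using f that by (metis Lambda_N_E)
  obtain k where k: "\<And>m. coeff g m \<noteq> 0 \<Longrightarrow> size m \<le> k"
    using g by (metis Lambda_N_E)
  show ?thesis
  proof (rule Lambda_N_I[where n = "n * k"])
    fix \<sigma> :: "nat \<Rightarrow> nat" and m assume \<sigma>: "bij \<sigma>"
    obtain \<tau> where \<tau>: "bij \<tau>" and y\<tau>: "\<And>i. y (\<tau> i) = map_option (image_mset \<sigma>) (y i)"
      using enumeration_permute[OF y g \<sigma>] by metis
    have A: "image_mset \<tau> a \<in> A (image_mset \<sigma> m) \<longleftrightarrow> a \<in> A m" for a
    proof -
      have None: "None \<in> y ` set_mset (image_mset \<tau> a) \<longleftrightarrow> None \<in> y ` set_mset a"
        by (auto simp: y\<tau> image_iff) (metis y\<tau> option.map_disc_iff)+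
      have "(\<Sum>i\<in>#image_mset \<tau> a. the (y i)) = image_mset \<sigma> (\<Sum>i\<in>#a. the (y i))"
        if "None \<notin> y ` set_mset a"
        using that by (induction a) (auto simp: y\<tau> option.map_sel image_iff)
      then show ?thesis
        using None by (auto simp: A_def f_inv[OF \<tau>] image_mset_bij_eq_iff[OF \<sigma>])
    qed
    have "(\<Sum>a\<in>A (image_mset \<sigma> m). coeff f a) = (\<Sum>a\<in>A m. coeff f a)"
    proof (rule sum.reindex_bij_witness[where i = "image_mset \<tau>" and j = "image_mset (inv \<tau>)"])
      fix a assume a: "a \<in> A (image_mset \<sigma> m)"
      show "image_mset (inv \<tau>) a \<in> A m"
        using a A[of "image_mset (inv \<tau>) a"] by (simp only: image_mset_bij_inv[OF \<tau>])
      show "coeff f (image_mset (inv \<tau>) a) = coeff f a"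
        using f_inv[OF bij_imp_bij_inv[OF \<tau>]] .
    qed (simp_all only: A image_mset_bij_inv[OF \<tau>])
    then show "coeff (plethysm f g) (image_mset \<sigma> m) = coeff (plethysm f g) m"
      by (simp add: c)
  next
    fix m assume "coeff (plethysm f g) m \<noteq> 0"
    then obtain a where a: "a \<in> A m"
      by (auto simp: c elim: sum.not_neutral_contains_not_neutral)
    have deg: "size (the (y i)) \<le> k" if "y i \<noteq> None" for i
    proof -
      obtain b where b: "y i = Some b"
        using \<open>y i \<noteq> None\<close> by (cases "y i") auto
      then have "coeff g b \<noteq> 0"
        using y by (auto simp: monomial_enumeration_def dest!: spec[of _ b])
      then show ?thesis
        using k b by simp
    qed
    have "size (\<Sum>i\<in>#a. the (y i)) \<le> size a * k"
      if "None \<notin> y ` set_mset a" for a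
      using that
    proof (induction a)
      case (add i a)
      then have "size (the (y i)) \<le> k"
        by (intro deg) (metis image_eqI union_single_eq_member)
      then show ?case
        using add by auto
    qed simp
    then have "size m \<le> size a * k"
      using a by (auto simp: A_def)
    also have "\<dots> \<le> n * k"
      using a n by (simp add: A_def)
    finally show "size m \<le> n * k" .
  next
    show "coeff (plethysm f g) m \<ge> 0" for m
      unfolding c using f by (meson Lambda_N_E sum_nonneg)
  qed
qed

lemma Lambda_N_plethysm_power: "f \<in> Lambda_N \<Longrightarrow> plethysm_power f n \<in> Lambda_N"
  unfolding plethysm_power_def by (induction n) (simp_all add: Lambda_N_power_sum Lambda_N_plethysm)

lemma d_in_Lambda_N: "d p i j \<in> Lambda_N"
  by (simp add: d_def psi_def Lambda_N_plethysm Lambda_N_plethysm_power Lambda_N_delta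
      Lambda_N_power_sum)

lemma Lambda_typ_subset_Lambda_N: "Lambda_typ p \<subseteq> Lambda_N"
proof
  fix f assume "f \<in> Lambda_typ p"
  then show "f \<in> Lambda_N"
    unfolding Lambda_typ_def
    by induction
      (auto intro: Lambda_N_zero Lambda_N_one Lambda_N_add Lambda_N_mult d_in_Lambda_N)
qed


section \<open>Typical Witt vectors with coefficients in a semiring\<close>

definition semiring_homs :: "'a::comm_semiring_1 set \<Rightarrow> ('a \<Rightarrow> 'b::comm_semiring_1) set" where
  "semiring_homs S = {a \<in> extensional S. a 0 = 0 \<and> a 1 = 1 \<and>
     (\<forall>f\<in>S. \<forall>g\<in>S. a (f + g) = a f + a g \<and> a (f * g) = a f * a g)}"

definition witt :: "nat \<Rightarrow> (nat mps \<Rightarrow> 'a::comm_semiring_1) set" where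
  "witt p = semiring_homs (Lambda_typ p)"

text \<open>
  The tensor product of symmetric functions is realised inside the power series in two alphabets
  \<open>x\<^sub>i \<otimes> 1\<close> (\<^term>\<open>Inl i\<close>) and \<open>1 \<otimes> x\<^sub>i\<close> (\<^term>\<open>Inr i\<close>), with \<open>f \<otimes> g\<close> being the
  product of \<open>f\<close> in the first and \<open>g\<close> in the second alphabet.
\<close>

definition tensor :: "nat mps \<Rightarrow> nat mps \<Rightarrow> (nat + nat) mps" where
  "tensor f g = msubst (\<lambda>i. Some {#Inl i#}) f * msubst (\<lambda>i. Some {#Inr i#}) g"

definition Delta_plus :: "nat mps \<Rightarrow> (nat + nat) mps" where
  "Delta_plus = msubst (\<lambda>n. Some {#sum_decode n#})"

definition Delta_times :: "nat mps \<Rightarrow> (nat + nat) mps" where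
  "Delta_times = msubst (\<lambda>n. case prod_decode n of (i, j) \<Rightarrow> Some {#Inl i, Inr j#})"

text \<open>
  The additive map on \<open>S \<otimes> S\<close> sending \<open>f \<otimes> g\<close> to \<open>a f * b g\<close>. The value does not depend on
  the representation of \<open>t\<close> as a sum of pure tensors if the tensor product of \<open>S\<close> with itself
  over \<open>\<nat>\<close> embeds into power series, which holds for \<^const>\<open>Lambda_typ\<close>.
\<close>

definition tensor_eval ::
  "nat mps set \<Rightarrow> (nat mps \<Rightarrow> 'a) \<Rightarrow> (nat mps \<Rightarrow> 'a) \<Rightarrow> (nat + nat) mps \<Rightarrow> 'a::comm_semiring_1" where
  "tensor_eval S a b t = (THE c. \<exists>ts. set ts \<subseteq> S \<times> S \<and>
     t = (\<Sum>(f, g)\<leftarrow>ts. tensor f g) \<and> c = (\<Sum>(f, g)\<leftarrow>ts. a f * b g))"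

definition witt_add ::
  "nat \<Rightarrow> (nat mps \<Rightarrow> 'a) \<Rightarrow> (nat mps \<Rightarrow> 'a) \<Rightarrow> nat mps \<Rightarrow> 'a::comm_semiring_1" where
  "witt_add p a b = (\<lambda>f\<in>Lambda_typ p. tensor_eval (Lambda_typ p) a b (Delta_plus f))"

definition witt_mult ::
  "nat \<Rightarrow> (nat mps \<Rightarrow> 'a) \<Rightarrow> (nat mps \<Rightarrow> 'a) \<Rightarrow> nat mps \<Rightarrow> 'a::comm_semiring_1" where
  "witt_mult p a b = (\<lambda>f\<in>Lambda_typ p. tensor_eval (Lambda_typ p) a b (Delta_times f))"

text \<open>
  \<open>f(0, 0, \<dots>)\<close> and \<open>f(1, 0, 0, \<dots>)\<close> are power series that are constant, with value in \<open>\<nat>\<close>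
  if \<open>f\<close> is in \<^const>\<open>Lambda_N\<close>.
\<close>

definition witt_zero :: "nat \<Rightarrow> nat mps \<Rightarrow> 'a::comm_semiring_1" where
  "witt_zero p = (\<lambda>f\<in>Lambda_typ p. of_nat (nat (coeff (msubst (\<lambda>_. None) f :: nat mps) {#})))"

definition witt_one :: "nat \<Rightarrow> nat mps \<Rightarrow> 'a::comm_semiring_1" where
  "witt_one p = (\<lambda>f\<in>Lambda_typ p.
     of_nat (nat (coeff (msubst (\<lambda>i. if i = 0 then Some {#} else None) f :: nat mps) {#})))"

definition witt_le :: "nat \<Rightarrow> (nat mps \<Rightarrow> 'a::ord) \<Rightarrow> (nat mps \<Rightarrow> 'a) \<Rightarrow> bool" where
  "witt_le p a b \<longleftrightarrow> (\<forall>f\<in>Lambda_typ p. a f \<le> b f)"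


section \<open>The Boolean semiring\<close>

text \<open>The library's order on \<^typ>\<open>bool\<close> satisfies \<open>0 < 1\<close> in the following semiring.\<close>

instantiation bool :: comm_semiring_1
begin

definition "0 = False"
definition "1 = True"
definition "x + y \<longleftrightarrow> x \<or> y"
definition "x * y \<longleftrightarrow> x \<and> y"

instance
  by standard (auto simp: zero_bool_def one_bool_def plus_bool_def times_bool_def)

end


section \<open>The set of pairs of natural numbers with a largest element\<close>

datatype nat2_top = Pair_nat nat nat | Infty

instantiation nat2_top :: order
begin

definition "u \<le> v \<longleftrightarrow> (case v of
    Infty \<Rightarrow> True
  | Pair_nat x' y' \<Rightarrow> (case u of Infty \<Rightarrow> False | Pair_nat x y \<Rightarrow> x \<le> x' \<and> y \<le> y'))"
definition "u < v \<longleftrightarrow> u \<le> v \<and> \<not> v \<le> (u :: nat2_top)"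

instance
  by standard (auto simp: less_eq_nat2_top_def less_nat2_top_def split: nat2_top.splits)

end

text \<open>The condition that singles out the Witt vector corresponding to an element of \<^typ>\<open>nat2_top\<close>.\<close>

fun corresponds :: "nat \<Rightarrow> nat2_top \<Rightarrow> (nat mps \<Rightarrow> bool) \<Rightarrow> bool" where
  "corresponds p (Pair_nat x y) a \<longleftrightarrow> (\<forall>i j. a (d p i j) = 0 \<longleftrightarrow> i \<ge> x \<and> j \<ge> y)"
| "corresponds p Infty a \<longleftrightarrow> (\<forall>i j. a (d p i j) = 1)"

definition boolean_witt :: "nat \<Rightarrow> nat2_top \<Rightarrow> nat mps \<Rightarrow> bool" where
  "boolean_witt p u = (THE a. a \<in> witt p \<and> corresponds p u a)"

end

theory Submission
  imports Defs Complex_Main "HOL-Library.Nonpos_Ints"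
begin

text \<open>
  A Boolean Witt vector \<open>a\<close> is determined by the values \<open>P i j\<close> of \<open>a\<close> on the generators
  \<open>d\<^sub>i\<^sub>,\<^sub>j\<close>. The relation \<open>d\<^sub>i\<^sub>,\<^sub>j ^ p = p d\<^sub>i\<^sub>+\<^sub>1\<^sub>,\<^sub>j + d\<^sub>i\<^sub>,\<^sub>j\<^sub>+\<^sub>1\<close> becomes
  \<open>P i j \<longleftrightarrow> P (i + 1) j \<or> P i (j + 1)\<close> in the Boolean semiring, and the nonempty zero sets of such
  patterns are exactly the quadrants \<open>i \<ge> x \<and> j \<ge> y\<close> (\<open>is_pattern_classification\<close>).

  It has to be shown that every pattern \<open>P\<close> does come from a homomorphism. It is obtained from
  homomorphisms to the complex numbers, namely evaluations at points. For given \<open>N\<close>, choose the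
  numbers \<open>r\<^sub>i\<^sub>,\<^sub>j\<close> with \<open>i + j = N\<close> as 0 or 1 according to \<open>P\<close>, and those with smaller
  \<open>i + j\<close> by extracting \<open>p\<close>-th roots in the relation; they are nonnegative and vanish exactly
  where \<open>P\<close> does. Since the power sums \<open>d\<^sub>0\<^sub>,\<^sub>j\<close> take arbitrary values at suitable points,
  and determine the other \<open>d\<^sub>i\<^sub>,\<^sub>j\<close>, there is a point \<open>x\<^sub>N\<close> where \<open>d\<^sub>i\<^sub>,\<^sub>j\<close> has the
  value \<open>r\<^sub>i\<^sub>,\<^sub>j\<close> whenever \<open>i + j \<le> N\<close> (\<open>exists_realization\<close>). Every element of the
  semiring generated by the \<open>d\<^sub>i\<^sub>,\<^sub>j\<close> therefore has nonnegative values at almost all \<open>x\<^sub>N\<close>,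
  and whether these are nonzero for large \<open>N\<close> is a Boolean-valued homomorphism. The same
  nonnegativity on a pair of alphabets shows that evaluating a tensor does not depend on its
  representation (\<open>tensor_eval_realized\<close>).

  The relation says that \<open>d\<^sub>i\<^sub>+\<^sub>1\<^sub>,\<^sub>j\<close> is the image of \<open>d\<^sub>i\<^sub>,\<^sub>j\<close> under the operation
  \<open>f \<mapsto> (f ^ p - \<psi> f) / p\<close>, with \<open>\<psi>\<close> the Frobenius lift raising all variables to the power \<open>p\<close>.
  Sums and products of Witt vectors are computed by following this operation on
  \<open>d\<^sub>0\<^sub>,\<^sub>j \<otimes> 1 + 1 \<otimes> d\<^sub>0\<^sub>,\<^sub>j\<close> and \<open>d\<^sub>0\<^sub>,\<^sub>j \<otimes> d\<^sub>0\<^sub>,\<^sub>j\<close>. The key is that for \<open>p > 2\<close> a sum of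
  two elements with Boolean value 1 again goes to such a sum, so that the value 1 persists under
  iteration (\<open>is_delta_two_terms\<close>). In the remaining cases one of the two Witt vectors acts like
  zero or, up to rescaling, like one. The resulting formulas for the values of \<open>a + b\<close> and
  \<open>a b\<close> on \<open>d\<^sub>i\<^sub>,\<^sub>j\<close> do not involve \<open>p\<close>
  (\<open>witt_add_in_witt_and_d\<close>, \<open>witt_mult_in_witt_and_d\<close>).
\<close>


section \<open>Linear functionals and substitutions on series of bounded degree\<close>

text \<open>
  Coefficients of a substituted series and values at a point are both obtained by extending a
  function on monomials linearly, so that one computation with sums serves both.
\<close>

definition linear_ext :: "('v multiset \<Rightarrow> 'c::comm_ring_1) \<Rightarrow> 'v mps \<Rightarrow> 'c" where
  "linear_ext h f = (\<Sum>a | coeff f a \<noteq> 0 \<and> h a \<noteq> 0. of_int (coeff f a) * h a)"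

lemma linear_ext_eq_sum:
  assumes "finite A" and "\<And>a. coeff f a \<noteq> 0 \<Longrightarrow> h a \<noteq> 0 \<Longrightarrow> a \<in> A"
  shows "linear_ext h f = (\<Sum>a\<in>A. of_int (coeff f a) * h a)"
  unfolding linear_ext_def using assms by (intro sum.mono_neutral_left) auto

lemma linear_ext_zero: "linear_ext h 0 = 0"
  by (simp add: linear_ext_def zero_mps_def)

lemma linear_ext_one: "linear_ext h 1 = h {#}"
  by (subst linear_ext_eq_sum[where A = "{{#}}"]) (auto simp: one_mps_def split: if_splits)

lemma linear_ext_add:
  assumes "finite {a. coeff f a \<noteq> 0 \<and> h a \<noteq> 0}" "finite {a. coeff g a \<noteq> 0 \<and> h a \<noteq> 0}"
  shows "linear_ext h (f + g) = linear_ext h f + linear_ext h g"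
proof -
  define A where "A = {a. coeff f a \<noteq> 0 \<and> h a \<noteq> 0} \<union> {a. coeff g a \<noteq> 0 \<and> h a \<noteq> 0}"
  have A: "finite A"
    using assms by (simp add: A_def)
  have "linear_ext h (f + g) = (\<Sum>a\<in>A. of_int (coeff (f + g) a) * h a)"
    by (rule linear_ext_eq_sum[OF A]) (auto simp: A_def plus_mps_def)
  moreover have "linear_ext h f = (\<Sum>a\<in>A. of_int (coeff f a) * h a)"
    by (rule linear_ext_eq_sum[OF A]) (auto simp: A_def)
  moreover have "linear_ext h g = (\<Sum>a\<in>A. of_int (coeff g a) * h a)"
    by (rule linear_ext_eq_sum[OF A]) (auto simp: A_def)
  ultimately show ?thesis
    by (simp add: plus_mps_def distrib_right sum.distrib)
qed

lemma linear_ext_mult: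
  assumes A: "finite A" and B: "finite B"
    and AB: "\<And>a b. coeff f a \<noteq> 0 \<Longrightarrow> coeff g b \<noteq> 0 \<Longrightarrow> h (a + b) \<noteq> 0 \<Longrightarrow> a \<in> A \<and> b \<in> B"
  shows "linear_ext h (f * g) =
    (\<Sum>a\<in>A. \<Sum>b\<in>B. of_int (coeff f a) * of_int (coeff g b) * h (a + b))"
proof -
  define C where "C = (\<lambda>(a, b). a + b) ` (A \<times> B)"
  let ?t = "\<lambda>a b. of_int (coeff f a) * of_int (coeff g b) * h (a + b)"
  have C: "finite C"
    using A B by (simp add: C_def)
  have "linear_ext h (f * g) = (\<Sum>c\<in>C. of_int (coeff (f * g) c) * h c)"
  proof (rule linear_ext_eq_sum[OF C])
    fix c assume "coeff (f * g) c \<noteq> 0" and h: "h c \<noteq> 0"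
    then obtain a where a: "a \<subseteq># c" "coeff f a * coeff g (c - a) \<noteq> 0"
      by (auto simp: times_mps_def elim: sum.not_neutral_contains_not_neutral)
    then have "a \<in> A \<and> c - a \<in> B"
      using h by (intro AB) auto
    then show "c \<in> C"
      using a(1) unfolding C_def by (intro image_eqI[of _ _ "(a, c - a)"]) auto
  qed
  also have "\<dots> = (\<Sum>c\<in>C. \<Sum>a | a \<subseteq># c. of_int (coeff f a) * of_int (coeff g (c - a)) * h c)"
    by (rule sum.cong) (auto simp: times_mps_def sum_distrib_right)
  also have "\<dots> = (\<Sum>(c, a)\<in>(SIGMA c:C. {a. a \<subseteq># c}).
      of_int (coeff f a) * of_int (coeff g (c - a)) * h c)"
    by (simp add: sum.Sigma C finite_submultisets)
  also have "\<dots> = (\<Sum>(c, a)\<in>{x\<in>(SIGMA c:C. {a. a \<subseteq># c}). snd x \<in> A \<and> fst x - snd x \<in> B}.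
      of_int (coeff f a) * of_int (coeff g (c - a)) * h c)"
  proof (rule sum.mono_neutral_right)
    show "finite (SIGMA c:C. {a. a \<subseteq># c})"
      using C finite_submultisets by blast
    show "\<forall>i\<in>(SIGMA c:C. {a. a \<subseteq># c}) -
        {x \<in> SIGMA c:C. {a. a \<subseteq># c}. snd x \<in> A \<and> fst x - snd x \<in> B}.
        (case i of (c, a) \<Rightarrow> of_int (coeff f a) * of_int (coeff g (c - a)) * h c) = 0"
    proof (intro ballI, rule ccontr)
      fix i
      assume i: "i \<in> (SIGMA c:C. {a. a \<subseteq># c}) -
          {x \<in> SIGMA c:C. {a. a \<subseteq># c}. snd x \<in> A \<and> fst x - snd x \<in> B}"
        and nz: "(case i of (c, a) \<Rightarrow> of_int (coeff f a) * of_int (coeff g (c - a)) * h c) \<noteq> 0"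
      obtain c a where ca: "i = (c, a)"
        by (cases i)
      with nz i have "coeff f a \<noteq> 0" "coeff g (c - a) \<noteq> 0" "h (a + (c - a)) \<noteq> 0"
        by auto
      then have "a \<in> A \<and> c - a \<in> B"
        by (rule AB)
      then show False
        using i ca by auto
    qed
  qed auto
  also have "\<dots> = (\<Sum>(a, b)\<in>A \<times> B. ?t a b)"
    by (rule sum.reindex_bij_witness[where i = "\<lambda>(a, b). (a + b, a)" and j = "\<lambda>(c, a). (a, c - a)"])
      (auto simp: C_def)
  finally show ?thesis
    by (simp add: sum.cartesian_product)
qed

text \<open>The image of a monomial under substitution, with the value zero represented by \<^const>\<open>None\<close>.\<close>

definition monomial_subst :: "('v \<Rightarrow> 'w multiset option) \<Rightarrow> 'v multiset \<Rightarrow> 'w multiset option" where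
  "monomial_subst y a = (if None \<in> y ` set_mset a then None else Some (\<Sum>i\<in>#a. the (y i)))"

lemma monomial_subst_empty: "monomial_subst y {#} = Some {#}"
  by (simp add: monomial_subst_def)

lemma monomial_subst_union_Some:
  "monomial_subst y (a + b) = Some m \<longleftrightarrow>
    (\<exists>c. c \<subseteq># m \<and> monomial_subst y a = Some c \<and> monomial_subst y b = Some (m - c))"
  by (auto simp: monomial_subst_def image_Un)

lemma coeff_msubst: "coeff (msubst y f) m = linear_ext (\<lambda>a. of_bool (monomial_subst y a = Some m)) f"
proof -
  have "{a. coeff f a \<noteq> 0 \<and> None \<notin> y ` set_mset a \<and> (\<Sum>i\<in>#a. the (y i)) = m} =
    {a. coeff f a \<noteq> 0 \<and> of_bool (monomial_subst y a = Some m) \<noteq> (0 :: int)}"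
    by (auto simp: monomial_subst_def)
  then show ?thesis
    unfolding msubst_def linear_ext_def by (auto intro!: sum.cong)
qed

lemma finite_multisets_bounded:
  assumes "finite V"
  shows "finite {a. set_mset a \<subseteq> V \<and> size a \<le> n}"
proof (rule finite_subset)
  show "{a. set_mset a \<subseteq> V \<and> size a \<le> n} \<subseteq> mset ` {xs. set xs \<subseteq> V \<and> length xs \<le> n}"
  proof
    fix a assume a: "a \<in> {a. set_mset a \<subseteq> V \<and> size a \<le> n}"
    obtain xs where "a = mset xs"
      by (metis ex_mset)
    with a show "a \<in> mset ` {xs. set xs \<subseteq> V \<and> length xs \<le> n}"
      by auto
  qed
qed (simp add: finite_lists_length_le assms)

text \<open>
  On series of bounded degree, the substitutions with this property are homomorphisms: a monomial
  then arises from finitely many monomials of a given degree.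
\<close>

definition finite_fibres :: "('v \<Rightarrow> 'w multiset option) \<Rightarrow> bool" where
  "finite_fibres y \<longleftrightarrow> (\<forall>m. finite {i. y i = Some m})"

lemma finite_fibres_inj: "inj y \<Longrightarrow> finite_fibres (\<lambda>i. Some (y i))"
  unfolding finite_fibres_def
  using finite_vimageI[of "{m}" y for m] by (auto simp: vimage_def)

lemma finite_monomial_preimages:
  assumes y: "finite_fibres y" and f: "bounded_degree f"
  shows "finite {a. coeff f a \<noteq> 0 \<and> (\<exists>c. c \<subseteq># m \<and> monomial_subst y a = Some c)}"
proof -
  obtain n where n: "\<And>a. coeff f a \<noteq> 0 \<Longrightarrow> size a \<le> n"
    using f by (auto simp: bounded_degree_def)
  define V where "V = (\<Union>c\<in>{c. c \<subseteq># m}. {i. y i = Some c})"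
  have V: "finite V"
    using y by (simp add: V_def finite_submultisets finite_fibres_def)
  have "{a. coeff f a \<noteq> 0 \<and> (\<exists>c. c \<subseteq># m \<and> monomial_subst y a = Some c)} \<subseteq>
    {a. set_mset a \<subseteq> V \<and> size a \<le> n}"
  proof clarsimp
    fix a c assume a: "coeff f a \<noteq> 0" and c: "c \<subseteq># m" "monomial_subst y a = Some c"
    have "i \<in> V" if "i \<in># a" for i
    proof -
      have None: "None \<notin> y ` set_mset a" and sum: "c = (\<Sum>i\<in>#a. the (y i))"
        using c by (auto simp: monomial_subst_def split: if_splits)
      have "the (y i) \<subseteq># c"
        using that unfolding sum by (auto dest!: multi_member_split)
      moreover have "y i = Some (the (y i))"
        using that None by (metis image_eqI option.collapse)
      ultimately show ?thesis
        using c(1) unfolding V_def by (auto intro: subset_mset.trans)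
    qed
    then show "set_mset a \<subseteq> V \<and> size a \<le> n"
      using n[OF a] by auto
  qed
  then show ?thesis
    using finite_multisets_bounded[OF V] by (rule finite_subset)
qed

lemma finite_monomial_preimage:
  assumes "finite_fibres y" and "bounded_degree f"
  shows "finite {a. coeff f a \<noteq> 0 \<and> monomial_subst y a = Some m}"
  by (rule finite_subset[OF _ finite_monomial_preimages[OF assms, of m]]) auto

lemma msubst_zero: "msubst y 0 = 0"
  by (rule mps_eqI) (simp add: coeff_msubst linear_ext_zero, simp add: zero_mps_def)

lemma msubst_one: "msubst y 1 = 1"
  by (rule mps_eqI) (auto simp: coeff_msubst linear_ext_one monomial_subst_empty, auto simp: one_mps_def)

lemma msubst_add:
  assumes "finite_fibres y" "bounded_degree f" "bounded_degree g"
  shows "msubst y (f + g) = msubst y f + msubst y g"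
proof (rule mps_eqI)
  fix m
  show "coeff (msubst y (f + g)) m = coeff (msubst y f + msubst y g) m"
    using finite_monomial_preimage[OF assms(1,2), of m] finite_monomial_preimage[OF assms(1,3), of m]
    by (simp add: coeff_msubst linear_ext_add) (simp add: plus_mps_def coeff_msubst)
qed

lemma msubst_mult:
  assumes y: "finite_fibres y" and f: "bounded_degree f" and g: "bounded_degree g"
  shows "msubst y (f * g) = msubst y f * msubst y g"
proof (rule mps_eqI)
  fix m
  let ?h = "\<lambda>m a. of_bool (monomial_subst y a = Some m) :: int"
  define A where "A = {a. coeff f a \<noteq> 0 \<and> (\<exists>c. c \<subseteq># m \<and> monomial_subst y a = Some c)}"
  define B where "B = {a. coeff g a \<noteq> 0 \<and> (\<exists>c. c \<subseteq># m \<and> monomial_subst y a = Some c)}"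
  have A: "finite A" and B: "finite B"
    unfolding A_def B_def using finite_monomial_preimages y f g by blast+
  (* Extracting a coefficient is not multiplicative; on a product of monomials it is a sum over the factorizations of m. *)
  have split: "?h m (a + b) = (\<Sum>c | c \<subseteq># m. ?h c a * ?h (m - c) b)" for a b
  proof (cases "\<exists>c. c \<subseteq># m \<and> monomial_subst y a = Some c \<and> monomial_subst y b = Some (m - c)")
    case True
    then obtain c where c: "c \<subseteq># m" "monomial_subst y a = Some c" "monomial_subst y b = Some (m - c)"
      by blast
    have "(\<Sum>c | c \<subseteq># m. ?h c a * ?h (m - c) b) = (\<Sum>c'\<in>{c}. ?h c' a * ?h (m - c') b)"
      using c by (intro sum.mono_neutral_right) (auto simp: finite_submultisets)
    then show ?thesis
      using c by (auto simp: monomial_subst_union_Some)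
  next
    case False
    then have "(\<Sum>c | c \<subseteq># m. ?h c a * ?h (m - c) b) = 0"
      by (intro sum.neutral) auto
    with False show ?thesis
      by (simp add: monomial_subst_union_Some)
  qed
  have "coeff (msubst y (f * g)) m = (\<Sum>a\<in>A. \<Sum>b\<in>B. coeff f a * coeff g b * ?h m (a + b))"
    unfolding coeff_msubst
    by (subst linear_ext_mult[OF A B]) (auto simp: A_def B_def monomial_subst_union_Some)
  also have "\<dots> = (\<Sum>a\<in>A. \<Sum>b\<in>B. \<Sum>c | c \<subseteq># m. (coeff f a * ?h c a) * (coeff g b * ?h (m - c) b))"
    unfolding split by (simp add: sum_distrib_left mult_ac)
  also have "\<dots> = (\<Sum>a\<in>A. \<Sum>c | c \<subseteq># m. \<Sum>b\<in>B. (coeff f a * ?h c a) * (coeff g b * ?h (m - c) b))"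
    by (intro sum.cong refl sum.swap)
  also have "\<dots> = (\<Sum>c | c \<subseteq># m. \<Sum>a\<in>A. \<Sum>b\<in>B. (coeff f a * ?h c a) * (coeff g b * ?h (m - c) b))"
    by (rule sum.swap)
  also have "\<dots> = (\<Sum>c | c \<subseteq># m. linear_ext (?h c) f * linear_ext (?h (m - c)) g)"
  proof (rule sum.cong)
    fix c assume c: "c \<in> {c. c \<subseteq># m}"
    have f': "linear_ext (?h c) f = (\<Sum>a\<in>A. coeff f a * ?h c a)"
      using c by (subst linear_ext_eq_sum[OF A]) (auto simp: A_def)
    have g': "linear_ext (?h (m - c)) g = (\<Sum>b\<in>B. coeff g b * ?h (m - c) b)"
      by (subst linear_ext_eq_sum[OF B]) (auto simp: B_def)
    show "(\<Sum>a\<in>A. \<Sum>b\<in>B. (coeff f a * ?h c a) * (coeff g b * ?h (m - c) b)) =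
      linear_ext (?h c) f * linear_ext (?h (m - c)) g"
      unfolding f' g' by (simp add: sum_product)
  qed simp
  also have "\<dots> = coeff (msubst y f * msubst y g) m"
    by (simp add: times_mps_def coeff_msubst)
  finally show "coeff (msubst y (f * g)) m = coeff (msubst y f * msubst y g) m" .
qed

text \<open>
  Substituting first and applying a functional afterwards amounts to pulling the functional back
  along the substitution; it gives compositions of substitutions as well as values of substituted
  series.
\<close>

lemma linear_ext_msubst:
  fixes h :: "'w multiset \<Rightarrow> 'c::comm_ring_1"
  assumes fin: "finite {a. coeff f a \<noteq> 0 \<and> (\<exists>m. monomial_subst y a = Some m \<and> h m \<noteq> 0)}"
  shows "linear_ext h (msubst y f) =
    linear_ext (\<lambda>a. case monomial_subst y a of None \<Rightarrow> 0 | Some m \<Rightarrow> h m) f"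
proof -
  define S where "S = {a. coeff f a \<noteq> 0 \<and> (\<exists>m. monomial_subst y a = Some m \<and> h m \<noteq> 0)}"
  define M where "M = (\<lambda>a. the (monomial_subst y a)) ` S"
  let ?e = "\<lambda>m a. of_bool (monomial_subst y a = Some m)"
  have S: "finite S" and M: "finite M"
    using fin by (auto simp: S_def M_def)
  have coeff: "h m * of_int (coeff (msubst y f) m) =
      h m * of_int (\<Sum>a\<in>S. coeff f a * ?e m a)" for m
  proof (cases "h m = 0")
    case False
    then show ?thesis
      unfolding coeff_msubst by (subst linear_ext_eq_sum[OF S]) (auto simp: S_def)
  qed simp
  have "linear_ext h (msubst y f) = (\<Sum>m\<in>M. of_int (coeff (msubst y f) m) * h m)"
  proof (rule linear_ext_eq_sum[OF M])
    fix m assume "coeff (msubst y f) m \<noteq> 0" and h: "h m \<noteq> 0"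
    then obtain a where "coeff f a \<noteq> 0" "monomial_subst y a = Some m"
      by (auto simp: coeff_msubst linear_ext_def elim!: sum.not_neutral_contains_not_neutral split: if_splits)
    then show "m \<in> M"
      using h by (auto simp: M_def S_def image_iff intro!: exI[of _ a])
  qed
  also have "\<dots> = (\<Sum>m\<in>M. \<Sum>a\<in>S. of_int (coeff f a) * (?e m a * h m))"
    using coeff by (simp add: mult.commute sum_distrib_left mult_ac)
  also have "\<dots> = (\<Sum>a\<in>S. \<Sum>m\<in>M. of_int (coeff f a) * (?e m a * h m))"
    by (rule sum.swap)
  also have "\<dots> = (\<Sum>a\<in>S. of_int (coeff f a) * (case monomial_subst y a of None \<Rightarrow> 0 | Some m \<Rightarrow> h m))"
  proof (rule sum.cong)
    fix a assume a: "a \<in> S"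
    then obtain m where m: "monomial_subst y a = Some m"
      by (auto simp: S_def)
    have "m \<in> M"
      using a m unfolding M_def by (intro image_eqI[of _ _ a]) auto
    note m = m this
    have "(\<Sum>m'\<in>M. of_int (coeff f a) * (?e m' a * h m')) = (\<Sum>m'\<in>{m}. of_int (coeff f a) * (?e m' a * h m'))"
      using m M by (intro sum.mono_neutral_right) auto
    then show "(\<Sum>m'\<in>M. of_int (coeff f a) * (?e m' a * h m')) =
        of_int (coeff f a) * (case monomial_subst y a of None \<Rightarrow> 0 | Some m \<Rightarrow> h m)"
      using m by simp
  qed simp
  also have "\<dots> = linear_ext (\<lambda>a. case monomial_subst y a of None \<Rightarrow> 0 | Some m \<Rightarrow> h m) f"
    by (rule linear_ext_eq_sum[symmetric, OF S]) (auto simp: S_def split: option.splits)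
  finally show ?thesis .
qed

lemma bounded_degree_zero: "bounded_degree 0"
  by (simp add: bounded_degree_def zero_mps_def)

lemma bounded_degree_one: "bounded_degree 1"
  by (auto simp: bounded_degree_def one_mps_def intro!: exI[of _ 0])

lemma bounded_degree_add:
  assumes "bounded_degree f" "bounded_degree g"
  shows "bounded_degree (f + g)"
proof -
  obtain n k where "\<And>m. coeff f m \<noteq> 0 \<Longrightarrow> size m \<le> n" "\<And>m. coeff g m \<noteq> 0 \<Longrightarrow> size m \<le> k"
    using assms unfolding bounded_degree_def by blast
  then have "size m \<le> max n k" if "coeff (f + g) m \<noteq> 0" for m
    using that by (cases "coeff f m = 0") (auto simp: plus_mps_def le_max_iff_disj)
  then show ?thesis
    unfolding bounded_degree_def by blast
qed

lemma bounded_degree_mult: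
  assumes "bounded_degree f" "bounded_degree g"
  shows "bounded_degree (f * g)"
proof -
  obtain n k where nk: "\<And>m. coeff f m \<noteq> 0 \<Longrightarrow> size m \<le> n" "\<And>m. coeff g m \<noteq> 0 \<Longrightarrow> size m \<le> k"
    using assms unfolding bounded_degree_def by blast
  have "size m \<le> n + k" if nz: "coeff (f * g) m \<noteq> 0" for m
  proof -
    obtain a where a: "a \<subseteq># m" "coeff f a * coeff g (m - a) \<noteq> 0"
      using nz by (auto simp: times_mps_def elim: sum.not_neutral_contains_not_neutral)
    then have "size a + size (m - a) \<le> n + k"
      by (intro add_mono nk) auto
    then show ?thesis
      using a(1) by (simp add: size_Diff_submset)
  qed
  then show ?thesis
    unfolding bounded_degree_def by blast
qed

lemma bounded_degree_power: "bounded_degree f \<Longrightarrow> bounded_degree (f ^ n)"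
  by (induction n) (auto intro: bounded_degree_one bounded_degree_mult)

lemma bounded_degree_Lambda_N: "f \<in> Lambda_N \<Longrightarrow> bounded_degree f"
  by (simp add: Lambda_N_def Lambda_Z_def)

lemma bounded_degree_of_nat: "bounded_degree (of_nat n)"
  by (induction n) (auto intro: bounded_degree_one bounded_degree_zero bounded_degree_add)

lemma bounded_degree_generated:
  assumes "f \<in> subsemiring_generated X" "\<And>g. g \<in> X \<Longrightarrow> bounded_degree g"
  shows "bounded_degree f"
  using assms
  by induction (auto intro: bounded_degree_zero bounded_degree_one bounded_degree_add bounded_degree_mult)

lemma msubst_power:
  "finite_fibres y \<Longrightarrow> bounded_degree f \<Longrightarrow> msubst y (f ^ n) = msubst y f ^ n"
  by (induction n) (simp_all add: msubst_one msubst_mult bounded_degree_power)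

lemma msubst_of_nat: "finite_fibres y \<Longrightarrow> msubst y (of_nat n) = of_nat n"
  by (induction n) (simp_all add: msubst_one msubst_zero msubst_add bounded_degree_one bounded_degree_of_nat)


section \<open>Frobenius lifts and the operation delta\<close>

definition frob :: "nat \<Rightarrow> 'v mps \<Rightarrow> 'v mps" where
  "frob p = msubst (\<lambda>i. Some (replicate_mset p i))"

lemma sum_mset_repeat_mset: "(\<Sum>i\<in>#repeat_mset p a. f i) = repeat_mset p (\<Sum>i\<in>#a. f i :: 'b multiset)"
  by (induction p) simp_all

lemma repeat_mset_inj: "p > 0 \<Longrightarrow> repeat_mset p a = repeat_mset p b \<longleftrightarrow> a = b"
  by (auto simp: multiset_eq_iff)

lemma subset_repeat_mset: "p > 0 \<Longrightarrow> a \<subseteq># repeat_mset p a"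
  by (auto simp: subseteq_mset_def)

lemma monomial_subst_replicate:
  "monomial_subst (\<lambda>i. Some (replicate_mset p i)) a = Some (repeat_mset p a)"
proof -
  have "(\<Sum>i\<in>#a. replicate_mset p i) = repeat_mset p a"
    by (induction a) (simp_all add: multiset_eq_iff)
  then show ?thesis
    by (auto simp: monomial_subst_def)
qed

lemma monomial_subst_repeat:
  assumes "p > 0"
  shows "monomial_subst y (repeat_mset p a) = map_option (repeat_mset p) (monomial_subst y a)"
proof -
  have "set_mset (repeat_mset p a) = set_mset a"
    using assms by (auto simp flip: count_greater_zero_iff)
  then show ?thesis
    by (simp add: monomial_subst_def sum_mset_repeat_mset)
qed

lemma coeff_frob_repeat:
  assumes "p > 0"
  shows "coeff (frob p f) (repeat_mset p a) = coeff f a"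
  unfolding frob_def coeff_msubst
  by (subst linear_ext_eq_sum[where A = "{a}"])
    (use assms in \<open>auto simp: monomial_subst_replicate repeat_mset_inj\<close>)

lemma coeff_frob_eq_0: "(\<And>a. m \<noteq> repeat_mset p a) \<Longrightarrow> coeff (frob p f) m = 0"
  unfolding frob_def coeff_msubst
  by (subst linear_ext_eq_sum[where A = "{}"]) (auto simp: monomial_subst_replicate)

lemma bounded_degree_frob:
  assumes "bounded_degree f" "p > 0"
  shows "bounded_degree (frob p f)"
proof -
  obtain n where n: "\<And>a. coeff f a \<noteq> 0 \<Longrightarrow> size a \<le> n"
    using assms(1) by (auto simp: bounded_degree_def)
  have "size m \<le> p * n" if m: "coeff (frob p f) m \<noteq> 0" for m
  proof -
    obtain a where "m = repeat_mset p a"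
      using m coeff_frob_eq_0 by blast
    then show ?thesis
      using m n[of a] assms(2) by (simp add: coeff_frob_repeat)
  qed
  then show ?thesis
    unfolding bounded_degree_def by blast
qed

lemma finite_fibres_replicate: "p > 0 \<Longrightarrow> finite_fibres (\<lambda>i. Some (replicate_mset p i))"
  by (rule finite_fibres_inj, rule injI) (metis in_replicate_mset)

lemma frob_zero: "frob p 0 = 0"
  by (simp add: frob_def msubst_zero)

lemma frob_one: "frob p 1 = 1"
  by (simp add: frob_def msubst_one)

lemma frob_add:
  "p > 0 \<Longrightarrow> bounded_degree f \<Longrightarrow> bounded_degree g \<Longrightarrow> frob p (f + g) = frob p f + frob p g"
  by (simp add: frob_def msubst_add finite_fibres_replicate)

lemma frob_mult:
  "p > 0 \<Longrightarrow> bounded_degree f \<Longrightarrow> bounded_degree g \<Longrightarrow> frob p (f * g) = frob p f * frob p g"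
  by (simp add: frob_def msubst_mult finite_fibres_replicate)

lemma frob_power_sum:
  assumes "p > 0"
  shows "frob p (power_sum n) = power_sum (p * n)"
proof (rule mps_eqI)
  fix m
  have rep: "replicate_mset (p * n) i = repeat_mset p (replicate_mset n i)" for i :: nat
    by (simp add: multiset_eq_iff)
  show "coeff (frob p (power_sum n)) m = coeff (power_sum (p * n)) m"
  proof (cases "\<exists>a. m = repeat_mset p a")
    case True
    then show ?thesis
      using assms by (auto simp: coeff_frob_repeat power_sum_def rep repeat_mset_inj)
  next
    case False
    then show ?thesis
      by (auto simp: coeff_frob_eq_0 power_sum_def rep)
  qed
qed

text \<open>Frobenius raises all variables to the same power, which commutes with any substitution of monomials.\<close>

lemma msubst_frob:
  assumes y: "finite_fibres y" and f: "bounded_degree f" and p: "p > 0"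
  shows "msubst y (frob p f) = frob p (msubst y f)"
proof (rule mps_eqI)
  fix m
  let ?S = "{a. coeff f a \<noteq> 0 \<and> (\<exists>c. c \<subseteq># m \<and> monomial_subst y a = Some c)}"
  let ?h = "\<lambda>a. of_bool (\<exists>c. monomial_subst y a = Some c \<and> repeat_mset p c = m) :: int"
  have fin: "finite ?S"
    using y f by (rule finite_monomial_preimages)
  have "coeff (msubst y (frob p f)) m = linear_ext (\<lambda>a. of_bool (monomial_subst y a = Some m)) (frob p f)"
    by (simp add: coeff_msubst)
  also have "\<dots> = linear_ext ?h f"
    unfolding frob_def
    by (subst linear_ext_msubst, rule finite_subset[OF _ fin])
      (use p in \<open>auto simp: monomial_subst_replicate monomial_subst_repeat subset_repeat_mset
        intro!: arg_cong[where f = "\<lambda>h. linear_ext h f"]\<close>)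
  also have "\<dots> = linear_ext (\<lambda>a. of_bool (monomial_subst (\<lambda>i. Some (replicate_mset p i)) a = Some m)) (msubst y f)"
    by (subst linear_ext_msubst, rule finite_subset[OF _ fin])
      (use p in \<open>auto simp: monomial_subst_replicate subset_repeat_mset split: option.splits
        intro!: arg_cong[where f = "\<lambda>h. linear_ext h f"]\<close>)
  also have "\<dots> = coeff (frob p (msubst y f)) m"
    by (simp add: coeff_msubst frob_def)
  finally show "coeff (msubst y (frob p f)) m = coeff (frob p (msubst y f)) m" .
qed

lemma coeff_of_nat_mult: "coeff (of_nat n * f) m = int n * coeff f m"
proof -
  have "coeff 0 m = 0" "coeff (g + h) m = coeff g m + coeff h m" for g h :: "'a mps"
    by (simp_all add: zero_mps_def plus_mps_def)
  then show ?thesis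
    by (induction n) (simp_all add: distrib_right)
qed

lemma of_nat_mult_cancel:
  assumes "of_nat p * f = of_nat p * (g :: 'v mps)" "p > 0"
  shows "f = g"
proof (rule mps_eqI)
  show "coeff f m = coeff g m" for m
    using arg_cong[OF assms(1), of "\<lambda>f. coeff f m"] assms(2) by (simp add: coeff_of_nat_mult)
qed

text \<open>
  The operation of dividing \<open>f ^ p - frob p f\<close> by \<open>p\<close> is used as a relation, which avoids
  showing in advance that the division is exact.
\<close>

definition is_delta :: "nat \<Rightarrow> 'v mps \<Rightarrow> 'v mps \<Rightarrow> bool" where
  "is_delta p f h \<longleftrightarrow> of_nat p * h + frob p f = f ^ p"

lemma is_delta_unique: "is_delta p f h \<Longrightarrow> is_delta p f h' \<Longrightarrow> p > 0 \<Longrightarrow> h = h'"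
  unfolding is_delta_def by (metis add_right_cancel of_nat_mult_cancel)

lemma is_delta_msubst:
  assumes "is_delta p f h" "finite_fibres y" "bounded_degree f" "bounded_degree h" "p > 0"
  shows "is_delta p (msubst y f) (msubst y h)"
proof -
  have "msubst y (of_nat p * h + frob p f) = of_nat p * msubst y h + frob p (msubst y f)"
    using assms by (simp add: msubst_add msubst_mult msubst_of_nat bounded_degree_mult
        bounded_degree_of_nat bounded_degree_frob msubst_frob)
  then show ?thesis
    using assms by (simp add: is_delta_def msubst_power)
qed

lemma is_delta_zero: "p > 0 \<Longrightarrow> is_delta p 0 0"
  by (simp add: is_delta_def frob_zero zero_power)

lemma is_delta_one: "is_delta p 1 0"
  by (simp add: is_delta_def frob_one)

text \<open>The binomial theorem; the inner binomial coefficients are divisible by the prime \<open>p\<close>.\<close>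

lemma is_delta_add:
  assumes p: "prime p" and f: "is_delta p f h" "bounded_degree f" and g: "is_delta p g k" "bounded_degree g"
  shows "is_delta p (f + g) (h + k + (\<Sum>i\<in>{1..<p}. of_nat ((p choose i) div p) * f ^ i * g ^ (p - i)))"
    (is "is_delta p _ (_ + ?S)")
proof -
  have p0: "p > 0"
    using p by (rule prime_gt_0_nat)
  have "(f + g) ^ p = (\<Sum>i\<le>p. of_nat (p choose i) * f ^ i * g ^ (p - i))"
    by (rule binomial_ring)
  also have "{..p} = insert 0 (insert p {1..<p})"
    using p0 by auto
  also have "(\<Sum>i\<in>insert 0 (insert p {1..<p}). of_nat (p choose i) * f ^ i * g ^ (p - i)) =
      g ^ p + (f ^ p + (\<Sum>i\<in>{1..<p}. of_nat (p choose i) * f ^ i * g ^ (p - i)))"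
    using p0 by simp
  also have "(\<Sum>i\<in>{1..<p}. of_nat (p choose i) * f ^ i * g ^ (p - i)) =
      of_nat p * (\<Sum>i\<in>{1..<p}. of_nat ((p choose i) div p) * f ^ i * g ^ (p - i))"
    unfolding sum_distrib_left
  proof (rule sum.cong)
    fix i assume "i \<in> {1..<p}"
    then have "p dvd (p choose i)"
      using p by (intro dvd_choose_prime) auto
    then have "(p choose i) = p * ((p choose i) div p)"
      by simp
    then have "(of_nat (p choose i) :: 'a mps) = of_nat p * of_nat ((p choose i) div p)"
      by (metis of_nat_mult)
    then show "of_nat (p choose i) * f ^ i * g ^ (p - i) =
        of_nat p * (of_nat ((p choose i) div p) * f ^ i * g ^ (p - i))"
      by (simp add: mult.assoc)
  qed simp
  finally have binomial: "(f + g) ^ p = g ^ p + (f ^ p + of_nat p * ?S)" .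
  have pow: "f ^ p = of_nat p * h + frob p f" "g ^ p = of_nat p * k + frob p g"
    using f(1) g(1) by (simp_all add: is_delta_def)
  show ?thesis
    unfolding is_delta_def binomial frob_add[OF p0 f(2) g(2)] distrib_left pow
    by (simp only: add_ac)
qed

lemma is_delta_mult:
  assumes "p > 0" and f: "is_delta p f h" "bounded_degree f" and g: "is_delta p g k" "bounded_degree g"
  shows "is_delta p (f * g) (of_nat p * (h * k) + h * frob p g + frob p f * k)"
proof -
  have "(f * g) ^ p = (of_nat p * h + frob p f) * (of_nat p * k + frob p g)"
    using f(1) g(1) by (simp add: is_delta_def power_mult_distrib)
  then show ?thesis
    using assms by (simp add: is_delta_def frob_mult algebra_simps)
qed

lemma generated_sum:
  "(\<And>i. i \<in> I \<Longrightarrow> f i \<in> subsemiring_generated X) \<Longrightarrow> sum f I \<in> subsemiring_generated X"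
  by (induction I rule: infinite_finite_induct) (auto intro: subsemiring_generated.intros)

lemma generated_power: "f \<in> subsemiring_generated X \<Longrightarrow> f ^ n \<in> subsemiring_generated X"
  by (induction n) (auto intro: subsemiring_generated.intros)

lemma generated_of_nat: "of_nat n \<in> subsemiring_generated X"
  by (induction n) (auto intro: subsemiring_generated.intros)

text \<open>
  The correction terms in the two preceding formulas have natural number coefficients, so that
  \<^const>\<open>is_delta\<close> is total on a subsemiring as soon as it is defined on generators.
\<close>

lemma delta_closed_generated:
  assumes p: "prime p" and X: "\<And>g. g \<in> X \<Longrightarrow> bounded_degree g"
    and frob: "\<And>g. g \<in> X \<Longrightarrow> frob p g \<in> subsemiring_generated X"
    and delta: "\<And>g. g \<in> X \<Longrightarrow> \<exists>h\<in>subsemiring_generated X. is_delta p g h"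
    and f: "f \<in> subsemiring_generated X"
  shows "frob p f \<in> subsemiring_generated X \<and> (\<exists>h\<in>subsemiring_generated X. is_delta p f h)"
  using f
proof induction
  case zero
  show ?case
    using is_delta_zero[OF prime_gt_0_nat[OF p]]
    by (auto simp: frob_zero intro: subsemiring_generated.zero)
next
  case one
  show ?case
    using is_delta_one[of p] by (auto simp: frob_one intro: subsemiring_generated.intros)
next
  case (incl g)
  then show ?case
    using frob delta by blast
next
  case (add f g)
  then obtain h k where hk: "h \<in> subsemiring_generated X" "is_delta p f h"
      "k \<in> subsemiring_generated X" "is_delta p g k"
    by blast
  have bd: "bounded_degree f" "bounded_degree g"
    using add.hyps X bounded_degree_generated by blast+
  have "h + k + (\<Sum>i\<in>{1..<p}. of_nat ((p choose i) div p) * f ^ i * g ^ (p - i)) \<in> subsemiring_generated X"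
    by (intro subsemiring_generated.add subsemiring_generated.mult generated_sum generated_of_nat
        generated_power add.hyps hk)
  moreover have "frob p (f + g) \<in> subsemiring_generated X"
    unfolding frob_add[OF prime_gt_0_nat[OF p] bd] using add.IH by (blast intro: subsemiring_generated.add)
  ultimately show ?case
    using is_delta_add[OF p hk(2) bd(1) hk(4) bd(2)] by blast
next
  case (mult f g)
  then obtain h k where hk: "h \<in> subsemiring_generated X" "is_delta p f h"
      "k \<in> subsemiring_generated X" "is_delta p g k"
    by blast
  have bd: "bounded_degree f" "bounded_degree g"
    using mult.hyps X bounded_degree_generated by blast+
  have "of_nat p * (h * k) + h * frob p g + frob p f * k \<in> subsemiring_generated X"
    using mult.IH hk by (intro subsemiring_generated.add subsemiring_generated.mult generated_of_nat) blast+
  moreover have "frob p (f * g) \<in> subsemiring_generated X"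
    unfolding frob_mult[OF prime_gt_0_nat[OF p] bd] using mult.IH by (blast intro: subsemiring_generated.mult)
  ultimately show ?case
    using is_delta_mult[OF prime_gt_0_nat[OF p] hk(2) bd(1) hk(4) bd(2)] by blast
qed


section \<open>The generators\<close>

definition monomial :: "'v multiset \<Rightarrow> 'v mps" where
  "monomial a = Mps (\<lambda>m. of_bool (m = a))"

lemma monomial_mult: "monomial a * monomial b = monomial (a + b)"
proof (rule mps_eqI)
  fix m
  have "coeff (monomial a * monomial b) m = (\<Sum>c | c \<subseteq># m. of_bool (c = a \<and> m = a + b))"
    unfolding times_mps_def monomial_def coeff_Mps
    by (rule sum.cong) auto
  also have "\<dots> = (if m = a + b then 1 else 0)"
    by (auto simp: finite_submultisets of_bool_def)
  finally show "coeff (monomial a * monomial b) m = coeff (monomial (a + b)) m"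
    by (simp add: monomial_def)
qed

lemma is_delta_monomial:
  assumes "p > 0"
  shows "is_delta p (monomial a) 0"
proof -
  have pow: "monomial a ^ n = monomial (repeat_mset n a)" for n
    by (induction n) (simp_all add: monomial_mult, simp add: monomial_def one_mps_def of_bool_def)
  have "coeff (frob p (monomial a)) m = coeff (monomial (repeat_mset p a)) m" for m
  proof (cases "\<exists>b. m = repeat_mset p b")
    case True
    then show ?thesis
      using assms by (auto simp: coeff_frob_repeat monomial_def repeat_mset_inj)
  next
    case False
    then show ?thesis
      by (auto simp: coeff_frob_eq_0 monomial_def)
  qed
  then show ?thesis
    by (simp add: is_delta_def pow mps_eqI)
qed

lemma coeff_power_cong:
  assumes "\<And>a. a \<subseteq># m \<Longrightarrow> coeff f a = coeff g a" "b \<subseteq># m"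
  shows "coeff (f ^ n) b = coeff (g ^ n) b"
  using assms(2)
proof (induction n arbitrary: b)
  case (Suc n)
  have "coeff (f * f ^ n) b = coeff (g * g ^ n) b"
    unfolding times_mps_def coeff_Mps
  proof (rule sum.cong)
    fix a assume "a \<in> {a. a \<subseteq># b}"
    then have "a \<subseteq># m" "b - a \<subseteq># m"
      using Suc.prems by (auto intro: subset_mset.trans diff_subset_eq_self)
    then show "coeff f a * coeff (f ^ n) (b - a) = coeff g a * coeff (g ^ n) (b - a)"
      using assms(1) Suc.IH by simp
  qed simp
  then show ?case
    by simp
qed simp

text \<open>
  A given coefficient of \<open>power_sum 1 ^ p\<close> involves only finitely many variables, and for a
  finite sum of variables exactness of the division by \<open>p\<close> follows by adding one variable at a
  time.
\<close>

lemma is_delta_power_sum: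
  assumes p: "prime p"
  shows "is_delta p (power_sum 1) (delta p)"
  unfolding is_delta_def
proof (rule mps_eqI)
  fix m :: "nat multiset"
  have p0: "p > 0"
    using p by (rule prime_gt_0_nat)
  define s where "s = (\<lambda>I. Mps (\<lambda>a. of_bool (\<exists>i\<in>I. a = {#i :: nat#})))"
  have s_bd: "bounded_degree (s I)" for I
    unfolding bounded_degree_def by (rule exI[of _ 1]) (auto simp: s_def)
  have "\<exists>h. is_delta p (s I) h" if "finite I" for I
    using that
  proof induction
    case empty
    have "s {} = 0"
      by (simp add: s_def zero_mps_def)
    then show ?case
      using is_delta_zero[OF p0] by auto
  next
    case (insert i I)
    then obtain h where h: "is_delta p (s I) h"
      by blast
    have "s (insert i I) = monomial {#i#} + s I"
      using insert.hyps by (intro mps_eqI) (auto simp: s_def monomial_def plus_mps_def)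
    moreover have "bounded_degree (monomial {#i#})"
      unfolding bounded_degree_def by (rule exI[of _ 1]) (auto simp: monomial_def)
    ultimately show ?case
      using is_delta_add[OF p is_delta_monomial[OF p0] _ h s_bd] by auto
  qed
  then obtain h where h: "is_delta p (s (set_mset m)) h"
    by blast
  have s_eq: "coeff (s (set_mset m)) a = coeff (power_sum 1) a" if "a \<subseteq># m" for a
    using that by (auto simp: s_def power_sum_def dest: mset_subset_eqD)
  have "coeff (frob p (s (set_mset m))) m = coeff (frob p (power_sum 1)) m"
  proof (cases "\<exists>a. m = repeat_mset p a")
    case True
    then obtain a where "m = repeat_mset p a"
      by blast
    then show ?thesis
      using s_eq[of a] p0 by (simp add: coeff_frob_repeat subset_repeat_mset)
  next
    case False
    then show ?thesis
      by (auto simp: coeff_frob_eq_0)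
  qed
  moreover have "coeff (s (set_mset m) ^ p) m = coeff (power_sum 1 ^ p) m"
    by (rule coeff_power_cong[OF s_eq]) auto
  moreover have "coeff (of_nat p * h + frob p (s (set_mset m))) m = coeff (s (set_mset m) ^ p) m"
    using h by (simp add: is_delta_def)
  ultimately have "int p * coeff h m = coeff (power_sum 1 ^ p - power_sum p) m"
    using p0 by (simp add: plus_mps_def minus_mps_def coeff_of_nat_mult frob_power_sum)
  then have "int p dvd coeff (power_sum 1 ^ p - power_sum p) m"
    by (metis dvd_triv_left)
  then have "int p * coeff (delta p) m = coeff (power_sum 1 ^ p - power_sum p) m"
    by (simp add: delta_def)
  then show "coeff (of_nat p * delta p + frob p (power_sum 1)) m = coeff (power_sum 1 ^ p) m"
    using p0 by (simp add: plus_mps_def minus_mps_def coeff_of_nat_mult frob_power_sum)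
qed

lemma coeff_msubst_power_sum_1:
  assumes "finite_fibres y"
  shows "coeff (msubst y (power_sum 1)) m = int (card {i. y i = Some m})"
proof -
  let ?A = "(\<lambda>i. {#i#}) ` {i. y i = Some m}"
  have fin: "finite {i. y i = Some m}"
    using assms by (simp add: finite_fibres_def)
  have single: "monomial_subst y {#i#} = y i" for i
    by (cases "y i") (simp_all add: monomial_subst_def)
  have "coeff (msubst y (power_sum 1)) m =
      (\<Sum>a\<in>?A. of_int (coeff (power_sum 1) a) * of_bool (monomial_subst y a = Some m))"
    unfolding coeff_msubst
    by (rule linear_ext_eq_sum) (auto simp: fin power_sum_def single split: if_splits)
  also have "\<dots> = (\<Sum>a\<in>?A. 1)"
    by (rule sum.cong) (auto simp: single power_sum_def)
  also have "\<dots> = int (card {i. y i = Some m})"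
    by (simp add: card_image inj_on_def)
  finally show ?thesis .
qed

text \<open>
  The variables of \<open>f\<close> are replaced by the monomials of \<open>g\<close>, whose sum is \<open>g\<close>; as a
  homomorphism that commutes with Frobenius, plethysm is then controlled by the value \<open>g\<close> on
  \<open>power_sum 1\<close>.
\<close>

lemma plethysm_eq_msubst:
  assumes g: "g \<in> Lambda_N"
  obtains y where "finite_fibres y" "\<And>f. plethysm f g = msubst y f" "msubst y (power_sum 1) = g"
proof -
  define y where "y = (SOME y. monomial_enumeration g y)"
  have y: "monomial_enumeration g y"
    unfolding y_def using monomial_enumeration_exists[OF g] by (rule someI_ex)
  then have fib: "finite_fibres y"
    by (auto simp: finite_fibres_def monomial_enumeration_def)
  have "msubst y (power_sum 1) = g"
    by (rule mps_eqI, subst coeff_msubst_power_sum_1[OF fib]) (use y in \<open>auto simp: monomial_enumeration_def\<close>)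
  then show thesis
    using that fib by (metis plethysm_def y_def)
qed

lemma is_delta_plethysm:
  assumes "is_delta p f h" "bounded_degree f" "bounded_degree h" "p > 0" "g \<in> Lambda_N"
  shows "is_delta p (plethysm f g) (plethysm h g)"
  by (rule plethysm_eq_msubst[OF assms(5)]) (use assms is_delta_msubst in auto)

lemma plethysm_power_sum_1: "g \<in> Lambda_N \<Longrightarrow> plethysm (power_sum 1) g = g"
  by (metis plethysm_eq_msubst)

lemma plethysm_psi:
  assumes "g \<in> Lambda_N" "p > 0"
  shows "plethysm (psi p) g = frob p g"
proof (rule plethysm_eq_msubst[OF assms(1)])
  fix y :: "nat \<Rightarrow> nat multiset option"
  assume y: "finite_fibres y" "\<And>f. plethysm f g = msubst y f" "msubst y (power_sum 1) = g"
  have "psi p = frob p (power_sum 1)"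
    using assms(2) by (simp add: frob_power_sum psi_def)
  then show ?thesis
    using y assms by (simp add: msubst_frob bounded_degree_Lambda_N Lambda_N_power_sum)
qed

lemma plethysm_power_psi:
  assumes "p > 0"
  shows "plethysm_power (psi p) j = power_sum (p ^ j)"
  by (induction j) (use assms in \<open>simp_all add: plethysm_power_def plethysm_psi Lambda_N_power_sum frob_power_sum\<close>)

lemma d_0:
  assumes "p > 0"
  shows "d p 0 j = power_sum (p ^ j)"
  using assms by (simp add: d_def plethysm_power_psi plethysm_power_sum_1[unfolded One_nat_def]
      Lambda_N_power_sum) (simp add: plethysm_power_def plethysm_power_sum_1[unfolded One_nat_def] Lambda_N_power_sum)

text \<open>
  Substituting a series \<open>g\<close> into the relation between \<open>power_sum 1\<close> and \<open>delta p\<close> shows that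
  plethysm with \<open>delta p\<close> on the left is the operation applied to \<open>g\<close>. So the operation leads
  from each iterate of \<open>delta p\<close> to the next, also after a further substitution.
\<close>

lemma is_delta_d:
  assumes p: "prime p"
  shows "is_delta p (d p i j) (d p (Suc i) j)"
proof -
  have p0: "p > 0"
    using p by (rule prime_gt_0_nat)
  let ?e = "plethysm_power (delta p)"
  have "is_delta p (plethysm (power_sum 1) (?e i)) (plethysm (delta p) (?e i))"
    by (intro is_delta_plethysm is_delta_power_sum p p0 bounded_degree_Lambda_N Lambda_N_power_sum
        Lambda_N_delta Lambda_N_plethysm_power)
  then have "is_delta p (?e i) (?e (Suc i))"
    by (simp add: plethysm_power_sum_1[unfolded One_nat_def] Lambda_N_plethysm_power Lambda_N_delta)
      (simp add: plethysm_power_def)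
  then show ?thesis
    unfolding d_def psi_def
    by (intro is_delta_plethysm p0 bounded_degree_Lambda_N Lambda_N_power_sum
        Lambda_N_delta Lambda_N_plethysm_power)
qed

lemma frob_d:
  assumes p: "prime p"
  shows "frob p (d p i j) = d p i (Suc j)"
proof (induction i)
  case 0
  show ?case
    using prime_gt_0_nat[OF p] by (simp add: d_0 frob_power_sum)
next
  case (Suc i)
  have "is_delta p (frob p (d p i j)) (frob p (d p (Suc i) j))"
    using is_delta_msubst[OF is_delta_d[OF p] finite_fibres_replicate[OF prime_gt_0_nat[OF p]]]
    by (simp add: frob_def prime_gt_0_nat[OF p] bounded_degree_Lambda_N d_in_Lambda_N)
  then show ?case
    using is_delta_unique[OF _ is_delta_d[OF p, of i "Suc j"] prime_gt_0_nat[OF p]] Suc by metis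
qed

lemma d_relation: "prime p \<Longrightarrow> d p i j ^ p = of_nat p * d p (Suc i) j + d p i (Suc j)"
  using is_delta_d[of p i j] by (simp add: is_delta_def frob_d)

lemma d_in_Lambda_typ: "d p i j \<in> Lambda_typ p"
  unfolding Lambda_typ_def by (rule subsemiring_generated.incl) blast


section \<open>Values at finitely supported complex points\<close>

definition value_at :: "('v \<Rightarrow> complex) \<Rightarrow> 'v mps \<Rightarrow> complex" where
  "value_at x = linear_ext (\<lambda>a. \<Prod>i\<in>#a. x i)"

definition finitely_supported :: "('v \<Rightarrow> complex) \<Rightarrow> bool" where
  "finitely_supported x \<longleftrightarrow> finite {i. x i \<noteq> 0}"

lemma finite_value_at:
  assumes "finitely_supported x" "bounded_degree f"
  shows "finite {a. coeff f a \<noteq> 0 \<and> (\<Prod>i\<in>#a. x i) \<noteq> 0}"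
proof -
  obtain n where n: "\<And>a. coeff f a \<noteq> 0 \<Longrightarrow> size a \<le> n"
    using assms(2) by (auto simp: bounded_degree_def)
  have "{a. coeff f a \<noteq> 0 \<and> (\<Prod>i\<in>#a. x i) \<noteq> 0} \<subseteq> {a. set_mset a \<subseteq> {i. x i \<noteq> 0} \<and> size a \<le> n}"
  proof clarsimp
    fix a assume "coeff f a \<noteq> 0" "0 \<notin> x ` set_mset a"
    then show "set_mset a \<subseteq> {i. x i \<noteq> 0} \<and> size a \<le> n"
      using n[of a] by force
  qed
  then show ?thesis
    by (rule finite_subset) (use assms(1) in \<open>simp add: finite_multisets_bounded finitely_supported_def\<close>)
qed

lemma value_at_zero: "value_at x 0 = 0"
  by (simp add: value_at_def linear_ext_zero)

lemma value_at_one: "value_at x 1 = 1"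
  by (simp add: value_at_def linear_ext_one)

lemma value_at_add:
  assumes "finitely_supported x" "bounded_degree f" "bounded_degree g"
  shows "value_at x (f + g) = value_at x f + value_at x g"
  unfolding value_at_def by (intro linear_ext_add finite_value_at assms)

lemma value_at_mult:
  assumes x: "finitely_supported x" and f: "bounded_degree f" and g: "bounded_degree g"
  shows "value_at x (f * g) = value_at x f * value_at x g"
proof -
  let ?h = "\<lambda>a. \<Prod>i\<in>#a. x i"
  let ?A = "{a. coeff f a \<noteq> 0 \<and> ?h a \<noteq> 0}" and ?B = "{b. coeff g b \<noteq> 0 \<and> ?h b \<noteq> 0}"
  have A: "finite ?A" and B: "finite ?B"
    using assms finite_value_at by blast+
  have "value_at x (f * g) = (\<Sum>a\<in>?A. \<Sum>b\<in>?B. of_int (coeff f a) * of_int (coeff g b) * ?h (a + b))"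
    unfolding value_at_def by (rule linear_ext_mult[OF A B]) auto
  also have "\<dots> = (\<Sum>a\<in>?A. \<Sum>b\<in>?B. (of_int (coeff f a) * ?h a) * (of_int (coeff g b) * ?h b))"
    by (simp add: mult_ac)
  also have "\<dots> = value_at x f * value_at x g"
    unfolding value_at_def linear_ext_def by (simp add: sum_product)
  finally show ?thesis .
qed

lemma value_at_power:
  "finitely_supported x \<Longrightarrow> bounded_degree f \<Longrightarrow> value_at x (f ^ n) = value_at x f ^ n"
  by (induction n) (simp_all add: value_at_one value_at_mult bounded_degree_power)

lemma value_at_of_nat: "finitely_supported x \<Longrightarrow> value_at x (of_nat n) = of_nat n"
  by (induction n) (simp_all add: value_at_one value_at_zero value_at_add bounded_degree_one bounded_degree_of_nat)

lemma value_at_power_sum: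
  assumes x: "finitely_supported x" and n: "n > 0"
  shows "value_at x (power_sum n) = (\<Sum>i | x i \<noteq> 0. x i ^ n)"
proof -
  let ?V = "{i. x i \<noteq> 0}"
  have inj: "inj_on (replicate_mset n) ?V"
    by (rule inj_onI) (metis in_replicate_mset n)
  have "value_at x (power_sum n) =
      (\<Sum>a\<in>replicate_mset n ` ?V. of_int (coeff (power_sum n) a) * (\<Prod>i\<in>#a. x i))"
    unfolding value_at_def
  proof (rule linear_ext_eq_sum)
    fix a assume "coeff (power_sum n) a \<noteq> 0" "(\<Prod>i\<in>#a. x i) \<noteq> 0"
    then show "a \<in> replicate_mset n ` ?V"
      using n by (auto simp: power_sum_def split: if_splits)
  qed (use x in \<open>simp add: finitely_supported_def\<close>)
  also have "\<dots> = (\<Sum>a\<in>replicate_mset n ` ?V. (\<Prod>i\<in>#a. x i))"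
    by (rule sum.cong) (auto simp: power_sum_def)
  also have "\<dots> = (\<Sum>i\<in>?V. x i ^ n)"
    by (simp add: sum.reindex[OF inj])
  finally show ?thesis .
qed

lemma value_at_msubst:
  assumes f: "bounded_degree f" and fin: "finitely_supported z"
    and z: "\<And>i. z i = (case y i of None \<Rightarrow> 0 | Some m \<Rightarrow> \<Prod>k\<in>#m. x k)"
  shows "value_at x (msubst y f) = value_at z f"
proof -
  have eq: "(case monomial_subst y a of None \<Rightarrow> 0 | Some m \<Rightarrow> \<Prod>k\<in>#m. x k) = (\<Prod>i\<in>#a. z i)" for a
  proof (cases "None \<in> y ` set_mset a")
    case True
    then obtain i where "i \<in># a" "y i = None"
      by auto
    then have "0 \<in># image_mset z a"
      using z[of i] by force
    then show ?thesis
      using True by (auto simp: monomial_subst_def)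
  next
    case False
    have "(\<Prod>k\<in>#(\<Sum>i\<in>#a. the (y i)). x k) = (\<Prod>i\<in>#a. z i)"
      using False
    proof (induction a)
      case (add i a)
      then have "z i = (\<Prod>k\<in>#the (y i). x k)"
        using z[of i] by (cases "y i") auto
      then show ?case
        using add by simp
    qed simp
    then show ?thesis
      using False by (simp add: monomial_subst_def)
  qed
  have "finite {a. coeff f a \<noteq> 0 \<and> (\<exists>m. monomial_subst y a = Some m \<and> (\<Prod>k\<in>#m. x k) \<noteq> 0)}"
    by (rule finite_subset[OF _ finite_value_at[OF fin f]]) (auto simp flip: eq)
  then show ?thesis
    unfolding value_at_def by (subst linear_ext_msubst) (simp_all add: eq)
qed

lemma exists_complex_root:
  assumes "n > 0"
  shows "\<exists>t :: complex. t ^ n = w"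
proof
  show "rcis (root n (cmod w)) (Arg w / real n) ^ n = w"
    using assms by (simp add: DeMoivre2 rcis_cmod_Arg)
qed

text \<open>
  An explicit form of the algebraic independence of the power sums of orders \<open>p ^ j\<close>. The scaled \<open>p ^ N\<close>-th roots of unity have vanishing power sums of all
  orders \<open>p ^ j\<close> with \<open>j < N\<close>, so that they serve to correct the \<open>N\<close>-th value without
  changing the previous ones.
\<close>

lemma exists_list_with_power_sums:
  assumes p: "p > (1 :: nat)"
  shows "\<exists>xs :: complex list. \<forall>i\<le>N. (\<Sum>z\<leftarrow>xs. z ^ (p ^ i)) = v i"
proof (induction N)
  case 0
  show ?case
    by (rule exI[of _ "[v 0]"]) simp
next
  case (Suc N)
  then obtain xs where xs: "\<And>i. i \<le> N \<Longrightarrow> (\<Sum>z\<leftarrow>xs. z ^ (p ^ i)) = v i"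
    by blast
  define n where "n = p ^ Suc N"
  define \<zeta> where "\<zeta> = (\<lambda>k. cis (2 * pi * real k / real n))"
  have n: "n > 0"
    using p by (simp add: n_def)
  obtain t where t: "t ^ n = (v (Suc N) - (\<Sum>z\<leftarrow>xs. z ^ n)) / of_nat n"
    using exists_complex_root[OF n] by blast
  define ys where "ys = map (\<lambda>k. t * \<zeta> k) [0..<n]"
  have ys: "(\<Sum>z\<leftarrow>ys. z ^ m) = t ^ m * (\<Sum>k<n. \<zeta> m ^ k)" for m
  proof -
    have "\<zeta> k ^ m = \<zeta> m ^ k" for k
      by (simp add: \<zeta>_def DeMoivre mult_ac)
    then have "(\<Sum>z\<leftarrow>ys. z ^ m) = (\<Sum>k\<leftarrow>[0..<n]. t ^ m * \<zeta> m ^ k)"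
      by (simp add: ys_def o_def power_mult_distrib)
    also have "\<dots> = (\<Sum>k<n. t ^ m * \<zeta> m ^ k)"
      by (simp add: interv_sum_list_conv_sum_set_nat atLeast0LessThan)
    finally show ?thesis
      by (simp add: sum_distrib_left)
  qed
  have zero: "(\<Sum>z\<leftarrow>ys. z ^ (p ^ i)) = 0" if "i \<le> N" for i
  proof -
    have lt: "p ^ i < n"
      unfolding n_def using that p by (intro power_strict_increasing) auto
    have "inj_on \<zeta> {..<n}"
      using bij_betw_roots_unity[OF n] unfolding \<zeta>_def by (auto simp: bij_betw_def)
    then have "\<zeta> (p ^ i) \<noteq> \<zeta> 0"
      using lt p n by (auto dest!: inj_onD)
    then have ne: "\<zeta> (p ^ i) \<noteq> 1"
      by (simp add: \<zeta>_def)
    have "\<zeta> (p ^ i) ^ n = cis (2 * pi * real (p ^ i))"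
      using n by (simp add: \<zeta>_def DeMoivre)
    also have "\<dots> = 1"
      using cis_multiple_2pi[of "real (p ^ i)"] by simp
    finally have "(\<Sum>k<n. \<zeta> (p ^ i) ^ k) = 0"
      using geometric_sum[OF ne, of n] by simp
    then show ?thesis
      by (simp add: ys)
  qed
  have "\<zeta> n = 1"
    using n by (simp add: \<zeta>_def)
  then have last: "(\<Sum>z\<leftarrow>ys. z ^ n) = v (Suc N) - (\<Sum>z\<leftarrow>xs. z ^ n)"
    using n t by (simp add: ys)
  have "(\<Sum>z\<leftarrow>xs @ ys. z ^ (p ^ i)) = v i" if "i \<le> Suc N" for i
    using that xs zero last unfolding n_def by (cases "i = Suc N") simp_all
  then show ?case
    by blast
qed

lemma exists_point_with_power_sums:
  assumes p: "p > (1 :: nat)"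
  shows "\<exists>x :: nat \<Rightarrow> complex. finitely_supported x \<and> (\<forall>i\<le>N. value_at x (power_sum (p ^ i)) = v i)"
proof -
  obtain xs :: "complex list" where xs: "\<And>i. i \<le> N \<Longrightarrow> (\<Sum>z\<leftarrow>xs. z ^ (p ^ i)) = v i"
    using exists_list_with_power_sums[OF p] by blast
  define x where "x = (\<lambda>i. if i < length xs then xs ! i else 0)"
  have x: "finitely_supported x"
    unfolding finitely_supported_def by (rule finite_subset[of _ "{..<length xs}"]) (auto simp: x_def)
  have "value_at x (power_sum n) = (\<Sum>z\<leftarrow>xs. z ^ n)" if n: "n > 0" for n
  proof -
    have "(\<Sum>i | x i \<noteq> 0. x i ^ n) = (\<Sum>i<length xs. x i ^ n)"
      by (rule sum.mono_neutral_left) (use n in \<open>auto simp: x_def split: if_splits\<close>)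
    also have "\<dots> = (\<Sum>z\<leftarrow>xs. z ^ n)"
      by (simp add: x_def sum_list_sum_nth atLeast0LessThan)
    finally show ?thesis
      by (simp add: value_at_power_sum[OF x n])
  qed
  then show ?thesis
    using x xs p by (intro exI[of _ x]) auto
qed


section \<open>Boolean-valued homomorphisms from nonnegative values\<close>

text \<open>
  A semiring homomorphism to the nonnegative reals, followed by the map to the Boolean semiring
  that tests for being nonzero, is a homomorphism. As an element of a semiring with infinitely many
  generators involves only finitely many of them, it is enough to have points where more and
  more of the generators have nonnegative values.
\<close>

definition realizes :: "(nat \<Rightarrow> 'v \<Rightarrow> complex) \<Rightarrow> 'v mps \<Rightarrow> bool \<Rightarrow> bool" where
  "realizes x f b \<longleftrightarrow> (\<forall>\<^sub>F N in sequentially.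
     value_at (x N) f \<in> \<real>\<^sub>\<ge>\<^sub>0 \<and> (value_at (x N) f \<noteq> 0 \<longleftrightarrow> b))"

lemma nonneg_Reals_add_eq_0:
  assumes "z \<in> \<real>\<^sub>\<ge>\<^sub>0" "w \<in> \<real>\<^sub>\<ge>\<^sub>0"
  shows "z + w = 0 \<longleftrightarrow> z = 0 \<and> w = (0 :: complex)"
  using assms by (auto simp: complex_nonneg_Reals_iff complex_eq_iff)

lemma realizes_unique: "realizes x f b \<Longrightarrow> realizes x f c \<Longrightarrow> b = c"
  unfolding realizes_def
  by (drule (1) eventually_conj, drule eventually_happens) auto

lemma realizes_zero: "realizes x 0 False"
  by (simp add: realizes_def value_at_zero)

lemma realizes_one: "realizes x 1 True"
  by (simp add: realizes_def value_at_one)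

lemma realizes_of_nat: "(\<And>N. finitely_supported (x N)) \<Longrightarrow> realizes x (of_nat n) (n > 0)"
  by (simp add: realizes_def value_at_of_nat)

lemma realizes_add:
  assumes "realizes x f b" "realizes x g c" "bounded_degree f" "bounded_degree g"
    "\<And>N. finitely_supported (x N)"
  shows "realizes x (f + g) (b \<or> c)"
  using assms(1,2) unfolding realizes_def
  by eventually_elim (use assms(3-) in \<open>auto simp: value_at_add nonneg_Reals_add_eq_0\<close>)

lemma realizes_mult:
  assumes "realizes x f b" "realizes x g c" "bounded_degree f" "bounded_degree g"
    "\<And>N. finitely_supported (x N)"
  shows "realizes x (f * g) (b \<and> c)"
  using assms(1,2) unfolding realizes_def
  by eventually_elim (use assms(3-) in \<open>auto simp: value_at_mult\<close>)

lemma realizes_power: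
  assumes "realizes x f b" "bounded_degree f" "\<And>N. finitely_supported (x N)" "n > 0"
  shows "realizes x (f ^ n) b"
  using assms(1) unfolding realizes_def
  by eventually_elim (use assms(2-) in \<open>auto simp: value_at_power\<close>)

lemma realizes_generated:
  assumes x: "\<And>N. finitely_supported (x N)"
    and X: "\<And>g. g \<in> X \<Longrightarrow> bounded_degree g" "\<And>g. g \<in> X \<Longrightarrow> \<exists>b. realizes x g b"
    and f: "f \<in> subsemiring_generated X"
  shows "\<exists>b. realizes x f b"
  using f
proof induction
  case zero
  show ?case
    using realizes_zero by blast
next
  case one
  show ?case
    using realizes_one by blast
next
  case (incl f)
  then show ?case
    using X(2) by blast
next
  case (add f g)
  then show ?case
    using realizes_add x bounded_degree_generated X(1) by metis
next
  case (mult f g)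
  then show ?case
    using realizes_mult x bounded_degree_generated X(1) by metis
qed

text \<open>The Boolean values of the \<open>d\<^sub>i\<^sub>,\<^sub>j\<close> that are compatible with the relations between them.\<close>

definition is_pattern :: "(nat \<Rightarrow> nat \<Rightarrow> bool) \<Rightarrow> bool" where
  "is_pattern P \<longleftrightarrow> (\<forall>i j. P i j \<longleftrightarrow> P (Suc i) j \<or> P i (Suc j))"

text \<open>
  The values with \<open>i + j \<ge> N\<close> can be prescribed; the others are then determined by extracting
  roots.
\<close>

lemma exists_nonneg_table:
  assumes p: "p > 0" and P: "is_pattern P"
  shows "\<exists>r :: nat \<Rightarrow> nat \<Rightarrow> real. (\<forall>i j. r i j \<ge> 0 \<and> (r i j \<noteq> 0 \<longleftrightarrow> P i j)) \<and>
    (\<forall>i j. i + j < N \<longrightarrow> r i j ^ p = real p * r (Suc i) j + r i (Suc j))"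
proof -
  have "\<exists>r :: nat \<Rightarrow> nat \<Rightarrow> real. (\<forall>i j. r i j \<ge> 0 \<and> (r i j \<noteq> 0 \<longleftrightarrow> P i j)) \<and>
    (\<forall>i j. i + j < N \<and> N \<le> i + j + k \<longrightarrow> r i j ^ p = real p * r (Suc i) j + r i (Suc j))" for k
  proof (induction k)
    case 0
    show ?case
      by (rule exI[of _ "\<lambda>i j. of_bool (P i j)"]) auto
  next
    case (Suc k)
    then obtain r :: "nat \<Rightarrow> nat \<Rightarrow> real" where r: "\<And>i j. r i j \<ge> 0" "\<And>i j. r i j \<noteq> 0 \<longleftrightarrow> P i j"
      "\<And>i j. i + j < N \<Longrightarrow> N \<le> i + j + k \<Longrightarrow> r i j ^ p = real p * r (Suc i) j + r i (Suc j)"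
      by metis
    define s where "s = (\<lambda>i j. if N = i + j + Suc k then root p (real p * r (Suc i) j + r i (Suc j)) else r i j)"
    have nonneg: "real p * r (Suc i) j + r i (Suc j) \<ge> 0" for i j
      using r(1) by simp
    have "s i j \<ge> 0" for i j
      using p nonneg r(1) by (simp add: s_def)
    moreover have "s i j \<noteq> 0 \<longleftrightarrow> P i j" for i j
    proof (cases "N = i + j + Suc k")
      case True
      have "real p * r (Suc i) j + r i (Suc j) = 0 \<longleftrightarrow> r (Suc i) j = 0 \<and> r i (Suc j) = 0"
        using p r(1)[of "Suc i" j] r(1)[of i "Suc j"] by (subst add_nonneg_eq_0_iff) auto
      moreover have "P i j \<longleftrightarrow> P (Suc i) j \<or> P i (Suc j)"
        using P unfolding is_pattern_def by blast
      ultimately show ?thesis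
        using True p r(2) by (auto simp: s_def)
    qed (simp add: s_def r(2))
    moreover have "s i j ^ p = real p * s (Suc i) j + s i (Suc j)"
      if "i + j < N" "N \<le> i + j + Suc k" for i j
      using that p nonneg r(3)[of i j] by (cases "N = i + j + Suc k") (simp_all add: s_def)
    ultimately show ?case
      by blast
  qed
  from this[of N] show ?thesis
    by auto
qed

lemma bounded_degree_d: "bounded_degree (d p i j)"
  by (simp add: bounded_degree_Lambda_N d_in_Lambda_N)

lemma value_at_d_Suc:
  assumes "prime p" "finitely_supported x"
  shows "value_at x (d p (Suc i) j) = (value_at x (d p i j) ^ p - value_at x (d p i (Suc j))) / of_nat p"
proof -
  have "value_at x (d p i j) ^ p = of_nat p * value_at x (d p (Suc i) j) + value_at x (d p i (Suc j))"
    using d_relation[OF assms(1), of i j] assms(2)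
    by (simp add: value_at_add value_at_mult value_at_of_nat bounded_degree_d bounded_degree_mult
        bounded_degree_of_nat flip: value_at_power)
  then show ?thesis
    using prime_gt_0_nat[OF assms(1)] by simp
qed

text \<open>
  As the \<open>d\<^sub>i\<^sub>,\<^sub>j\<close> are rational polynomials in the \<open>d\<^sub>0\<^sub>,\<^sub>j\<close>, and the values of these can be
  prescribed, the relations used for the table above are all that has to be satisfied.
\<close>

lemma exists_realization:
  assumes p: "prime p" and P: "is_pattern P"
  obtains x :: "nat \<Rightarrow> nat \<Rightarrow> complex" where "\<And>N. finitely_supported (x N)"
    and "\<And>i j. realizes x (d p i j) (P i j)"
proof -
  have p0: "p > 0"
    using p by (rule prime_gt_0_nat)
  have "\<exists>x. finitely_supported x \<and> (\<forall>i j. i + j \<le> N \<longrightarrow> value_at x (d p i j) \<in> \<real>\<^sub>\<ge>\<^sub>0 \<and>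
      (value_at x (d p i j) \<noteq> 0 \<longleftrightarrow> P i j))" for N
  proof -
    obtain r :: "nat \<Rightarrow> nat \<Rightarrow> real" where r: "\<And>i j. r i j \<ge> 0" "\<And>i j. r i j \<noteq> 0 \<longleftrightarrow> P i j"
        "\<And>i j. i + j < N \<Longrightarrow> r i j ^ p = real p * r (Suc i) j + r i (Suc j)"
      using exists_nonneg_table[OF p0 P, of N] by blast
    obtain x where x: "finitely_supported x"
        "\<And>i. i \<le> N \<Longrightarrow> value_at x (power_sum (p ^ i)) = complex_of_real (r 0 i)"
      using exists_point_with_power_sums[OF prime_gt_1_nat[OF p], of N "\<lambda>i. complex_of_real (r 0 i)"]
      by blast
    have "value_at x (d p i j) = complex_of_real (r i j)" if "i + j \<le> N" for i j
      using that
    proof (induction i arbitrary: j)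
      case 0
      then show ?case
        using x(2) by (simp add: d_0[OF p0])
    next
      case (Suc i)
      have "value_at x (d p (Suc i) j) = complex_of_real ((r i j ^ p - r i (Suc j)) / real p)"
        using Suc by (simp add: value_at_d_Suc[OF p x(1)])
      also have "\<dots> = complex_of_real (r (Suc i) j)"
        using r(3)[of i j] Suc.prems p0 by simp
      finally show ?case .
    qed
    then show ?thesis
      using x(1) r(1,2) by (intro exI[of _ x]) auto
  qed
  then obtain x where x: "\<And>N. finitely_supported (x N)"
    "\<And>N i j. i + j \<le> N \<Longrightarrow> value_at (x N) (d p i j) \<in> \<real>\<^sub>\<ge>\<^sub>0 \<and> (value_at (x N) (d p i j) \<noteq> 0 \<longleftrightarrow> P i j)"
    by metis
  have "realizes x (d p i j) (P i j)" for i j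
    unfolding realizes_def using eventually_ge_at_top[of "i + j"] by eventually_elim (use x(2) in blast)
  with x(1) that show thesis
    by blast
qed

lemma bounded_degree_Lambda_typ: "f \<in> Lambda_typ p \<Longrightarrow> bounded_degree f"
  using Lambda_typ_subset_Lambda_N bounded_degree_Lambda_N by blast

lemma witt_by_realization:
  assumes x: "\<And>N. finitely_supported (x N)" and a: "a \<in> extensional (Lambda_typ p)"
    and r: "\<And>f. f \<in> Lambda_typ p \<Longrightarrow> realizes x f (a f)"
  shows "a \<in> witt p"
proof -
  have a0: "a 0 = False"
    by (rule realizes_unique[OF r realizes_zero]) (simp add: Lambda_typ_def subsemiring_generated.zero)
  have a1: "a 1 = True"
    by (rule realizes_unique[OF r realizes_one]) (simp add: Lambda_typ_def subsemiring_generated.one)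
  have "a (f + g) = (a f \<or> a g)" "a (f * g) = (a f \<and> a g)"
    if fg: "f \<in> Lambda_typ p" "g \<in> Lambda_typ p" for f g
  proof -
    have bd: "bounded_degree f" "bounded_degree g"
      using fg bounded_degree_Lambda_typ by blast+
    show "a (f + g) = (a f \<or> a g)"
      by (rule realizes_unique[OF r realizes_add[OF r[OF fg(1)] r[OF fg(2)] bd x]])
        (use fg in \<open>simp add: Lambda_typ_def subsemiring_generated.add\<close>)
    show "a (f * g) = (a f \<and> a g)"
      by (rule realizes_unique[OF r realizes_mult[OF r[OF fg(1)] r[OF fg(2)] bd x]])
        (use fg in \<open>simp add: Lambda_typ_def subsemiring_generated.mult\<close>)
  qed
  then show ?thesis
    using a a0 a1
    by (simp add: witt_def semiring_homs_def zero_bool_def one_bool_def plus_bool_def times_bool_def)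
qed

lemma witt_simps:
  assumes "a \<in> witt p"
  shows "a 0 = False" "a 1 = True"
    "f \<in> Lambda_typ p \<Longrightarrow> g \<in> Lambda_typ p \<Longrightarrow> a (f + g) = (a f \<or> a g)"
    "f \<in> Lambda_typ p \<Longrightarrow> g \<in> Lambda_typ p \<Longrightarrow> a (f * g) = (a f \<and> a g)"
  using assms
  by (simp_all add: witt_def semiring_homs_def zero_bool_def one_bool_def plus_bool_def times_bool_def)

lemma witt_realized:
  assumes x: "\<And>N. finitely_supported (x N)" and a: "a \<in> witt p"
    and d: "\<And>i j. realizes x (d p i j) (a (d p i j))" and f: "f \<in> Lambda_typ p"
  shows "realizes x f (a f)"
  using f unfolding Lambda_typ_def
proof induction
  case zero
  show ?case
    using realizes_zero by (simp add: witt_simps[OF a])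
next
  case one
  show ?case
    using realizes_one by (simp add: witt_simps[OF a])
next
  case (incl f)
  then show ?case
    using d by auto
next
  case (add f g)
  then show ?case
    using realizes_add[OF add.IH _ _ x] bounded_degree_Lambda_typ
    by (simp add: witt_simps[OF a] Lambda_typ_def)
next
  case (mult f g)
  then show ?case
    using realizes_mult[OF mult.IH _ _ x] bounded_degree_Lambda_typ
    by (simp add: witt_simps[OF a] Lambda_typ_def)
qed

lemma witt_le_iff:
  assumes a: "a \<in> witt p" and b: "b \<in> witt p"
  shows "witt_le p a b \<longleftrightarrow> (\<forall>i j. a (d p i j) \<longrightarrow> b (d p i j))"
proof
  assume *: "\<forall>i j. a (d p i j) \<longrightarrow> b (d p i j)"
  have "a f \<longrightarrow> b f" if "f \<in> Lambda_typ p" for f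
    using that unfolding Lambda_typ_def
  proof induction
    case (add f g)
    then show ?case
      by (auto simp: witt_simps[OF a] witt_simps[OF b] Lambda_typ_def)
  next
    case (mult f g)
    then show ?case
      by (simp add: witt_simps[OF a] witt_simps[OF b] Lambda_typ_def)
  qed (use * in \<open>auto simp: witt_simps[OF a] witt_simps[OF b]\<close>)
  then show "witt_le p a b"
    by (simp add: witt_le_def le_bool_def)
qed (auto simp: witt_le_def le_bool_def d_in_Lambda_typ)

lemma witt_eqI:
  fixes a b :: "nat mps \<Rightarrow> bool"
  assumes a: "a \<in> witt p" and b: "b \<in> witt p" and "\<And>i j. a (d p i j) = b (d p i j)"
  shows "a = b"
proof (rule extensionalityI)
  show "a \<in> extensional (Lambda_typ p)" "b \<in> extensional (Lambda_typ p)"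
    using a b by (simp_all add: witt_def semiring_homs_def)
  have "witt_le p a b" "witt_le p b a"
    using assms by (simp_all add: witt_le_iff)
  then show "a f = b f" if "f \<in> Lambda_typ p" for f
    using that by (auto simp: witt_le_def le_bool_def)
qed

lemma witt_pattern:
  assumes p: "prime p" and a: "a \<in> witt p"
  shows "is_pattern (\<lambda>i j. a (d p i j))"
  unfolding is_pattern_def
proof (intro allI)
  fix i j
  have L: "of_nat n \<in> Lambda_typ p" "d p i j ^ n \<in> Lambda_typ p" for n i j
    unfolding Lambda_typ_def
    by (rule generated_of_nat, rule generated_power[OF d_in_Lambda_typ[unfolded Lambda_typ_def]])
  have L': "f + g \<in> Lambda_typ p" "f * g \<in> Lambda_typ p"
    if "f \<in> Lambda_typ p" "g \<in> Lambda_typ p" for f g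
    using that unfolding Lambda_typ_def by (auto intro: subsemiring_generated.intros)
  have nat: "a (of_nat (Suc n)) = True" for n
    using L(1)[of 1] by (simp add: witt_simps[OF a] L)
  have pow: "a (f ^ Suc n) = a f" if "\<And>n. f ^ n \<in> Lambda_typ p" for f n
  proof (induction n)
    case (Suc n)
    have "a (f ^ Suc (Suc n)) = (a f \<and> a (f ^ Suc n))"
      using witt_simps(4)[OF a, of f "f ^ Suc n"] that[of 1] that[of "Suc n"] by simp
    then show ?case
      using Suc by simp
  qed simp
  obtain n where n: "p = Suc n"
    using prime_gt_0_nat[OF p] gr0_implies_Suc by blast
  have "a (d p i j ^ p) = a (of_nat p * d p (Suc i) j + d p i (Suc j))"
    using d_relation[OF p] by simp
  moreover have "a (d p i j ^ p) = a (d p i j)"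
    using pow[of "d p i j" n] L(2) n by metis
  moreover have "a (of_nat p) = True"
    using nat n by metis
  ultimately show "a (d p i j) \<longleftrightarrow> a (d p (Suc i) j) \<or> a (d p i (Suc j))"
    by (simp add: witt_simps[OF a] L L' d_in_Lambda_typ)
qed

lemma exists_witt_with_pattern:
  assumes p: "prime p" and P: "is_pattern P"
  obtains a where "a \<in> witt p" "\<And>i j. a (d p i j) = P i j"
proof -
  obtain x :: "nat \<Rightarrow> nat \<Rightarrow> complex" where x: "\<And>N. finitely_supported (x N)"
    and d: "\<And>i j. realizes x (d p i j) (P i j)"
    using exists_realization[OF p P] by blast
  have "\<exists>b. realizes x f b" if "f \<in> Lambda_typ p" for f
    using that unfolding Lambda_typ_def
    by (rule realizes_generated[OF x, rotated 2]) (use d in \<open>auto simp: bounded_degree_d\<close>)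
  then obtain a where a: "\<And>f. f \<in> Lambda_typ p \<Longrightarrow> realizes x f (a f)"
    by metis
  have "restrict a (Lambda_typ p) \<in> witt p"
    by (rule witt_by_realization[OF x]) (use a in auto)
  moreover have "a (d p i j) = P i j" for i j
    using realizes_unique[OF a d] by (simp add: d_in_Lambda_typ)
  ultimately show thesis
    using that by (simp add: d_in_Lambda_typ)
qed


section \<open>Classification of Boolean Witt vectors\<close>

fun pattern :: "nat2_top \<Rightarrow> nat \<Rightarrow> nat \<Rightarrow> bool" where
  "pattern (Pair_nat x y) i j \<longleftrightarrow> i < x \<or> j < y"
| "pattern Infty i j \<longleftrightarrow> True"

lemma corresponds_iff: "corresponds p u a \<longleftrightarrow> (\<forall>i j. a (d p i j) = pattern u i j)"
proof (cases u)
  case (Pair_nat x y)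
  have "(b = 0 \<longleftrightarrow> i \<ge> x \<and> j \<ge> y) \<longleftrightarrow> (b = (i < x \<or> j < y))" for b i j
    by (auto simp: zero_bool_def not_le)
  then show ?thesis
    by (simp add: Pair_nat)
qed (simp add: one_bool_def)

lemma is_pattern_pattern: "is_pattern (pattern u)"
  by (cases u) (auto simp: is_pattern_def)

lemma pattern_le_iff: "(\<forall>i j. pattern u i j \<longrightarrow> pattern v i j) \<longleftrightarrow> u \<le> v"
proof
  assume *: "\<forall>i j. pattern u i j \<longrightarrow> pattern v i j"
  show "u \<le> v"
  proof (cases v)
    case v: (Pair_nat x' y')
    show ?thesis
    proof (cases u)
      case u: (Pair_nat x y)
      have "\<not> x' < x" "\<not> y' < y"
        using *[rule_format, of x' y'] v u by auto
      then show ?thesis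
        by (simp add: u v less_eq_nat2_top_def)
    next
      case Infty
      then show ?thesis
        using *[rule_format, of x' y'] v by simp
    qed
  qed (simp add: less_eq_nat2_top_def)
qed (auto simp: less_eq_nat2_top_def split: nat2_top.splits)

lemma pattern_inj: "pattern u = pattern v \<Longrightarrow> u = v"
  using pattern_le_iff[of u v] pattern_le_iff[of v u] by (simp add: order_antisym)

lemma is_pattern_mono:
  assumes P: "is_pattern P" and "P i' j'" "i \<le> i'" "j \<le> j'"
  shows "P i j"
proof -
  have iff: "P i j \<longleftrightarrow> P (Suc i) j \<or> P i (Suc j)" for i j
    by (rule P[unfolded is_pattern_def, rule_format])
  have "P i j" if "P (i + m) j" for m j
    using that
  proof (induction m)
    case (Suc m)
    then have "P (i + m) j"
      using iff[of "i + m" j] by (metis add_Suc_right)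
    then show ?case
      by (rule Suc.IH)
  qed simp
  moreover have "P i j" if "P i (j + n)" for n
    using that
  proof (induction n)
    case (Suc n)
    then have "P i (j + n)"
      using iff[of i "j + n"] by (metis add_Suc_right)
    then show ?case
      by (rule Suc.IH)
  qed simp
  moreover obtain m n where "i' = i + m" "j' = j + n"
    using assms(3,4) le_Suc_ex by blast
  ultimately show ?thesis
    using assms(2) by blast
qed

text \<open>
  The zeros of a pattern are closed under going up in either coordinate, and under going down to
  a point both of whose neighbours are zeros; by filling in rectangles, the minimum of two zeros is
  a zero.
\<close>

lemma is_pattern_fill:
  assumes P: "is_pattern P"
  shows "\<not> P (i + m) j \<Longrightarrow> \<not> P i (j + n) \<Longrightarrow> \<not> P i j"
proof (induction m arbitrary: i)
  case (Suc m)
  have "\<not> P (Suc i) (j + n)"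
    using Suc.prems(2) is_pattern_mono[OF P, of "Suc i" "j + n" i "j + n"] by auto
  then have 1: "\<not> P (Suc i) j"
    using Suc.IH[of "Suc i"] Suc.prems(1) by simp
  have "\<not> P i j'" if "j' \<le> j + n" "j \<le> j'" for j'
    using that
  proof (induction rule: inc_induct)
    case base
    show ?case
      by (rule Suc.prems(2))
  next
    case (step k)
    have "\<not> P (Suc i) k"
      using 1 is_pattern_mono[OF P, of "Suc i" k "Suc i" j] step.prems by auto
    then show ?case
      using step.IH step.prems P[unfolded is_pattern_def, rule_format, of i k] by simp
  qed
  then show ?case
    by simp
qed simp

lemma is_pattern_classification:
  assumes P: "is_pattern P"
  shows "\<exists>u. P = pattern u"
proof (cases "\<forall>i j. P i j")
  case True
  then have "P = pattern Infty"
    by (intro ext) simp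
  then show ?thesis
    by blast
next
  case False
  then obtain i0 j0 where ij0: "\<not> P i0 j0"
    by blast
  define x where "x = (LEAST i. \<exists>j. \<not> P i j)"
  define y where "y = (LEAST j. \<exists>i. \<not> P i j)"
  have "\<exists>j. \<not> P x j"
    unfolding x_def by (rule LeastI[of _ i0]) (use ij0 in blast)
  then obtain j1 where j1: "\<not> P x j1"
    by blast
  have "\<exists>i. \<not> P i y"
    unfolding y_def by (rule LeastI[of _ j0]) (use ij0 in blast)
  then obtain i1 where i1: "\<not> P i1 y"
    by blast
  have "x \<le> i1" "y \<le> j1"
    using i1 j1 unfolding x_def y_def by (blast intro: Least_le)+
  then have "\<not> P x y"
    using is_pattern_fill[OF P, of x "i1 - x" y "j1 - y"] i1 j1 by simp
  then have "P i j \<longleftrightarrow> i < x \<or> j < y" for i j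
    using is_pattern_mono[OF P, of i j x y] not_less_Least[of i "\<lambda>i. \<exists>j. \<not> P i j"]
      not_less_Least[of j "\<lambda>j. \<exists>i. \<not> P i j"] is_pattern_mono[OF P, of i j]
    unfolding x_def[symmetric] y_def[symmetric] by (meson not_le)
  then have "P = pattern (Pair_nat x y)"
    by (intro ext) simp
  then show ?thesis
    by blast
qed

lemma ex1_corresponds:
  assumes p: "prime p"
  shows "\<exists>!a. a \<in> witt p \<and> corresponds p u a"
  using exists_witt_with_pattern[OF p is_pattern_pattern[of u]] witt_eqI
  unfolding corresponds_iff by metis

lemma boolean_witt_in_witt:
  assumes "prime p"
  shows "boolean_witt p u \<in> witt p"
  using theI'[OF ex1_corresponds[OF assms, of u]] unfolding boolean_witt_def by blast

lemma boolean_witt_d: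
  assumes "prime p"
  shows "boolean_witt p u (d p i j) = pattern u i j"
  using theI'[OF ex1_corresponds[OF assms, of u]] unfolding boolean_witt_def corresponds_iff by blast

lemma boolean_witt_eqI:
  assumes "prime p" "a \<in> witt p" "\<And>i j. a (d p i j) = pattern u i j"
  shows "boolean_witt p u = a"
  by (rule witt_eqI[OF boolean_witt_in_witt[OF assms(1)] assms(2)])
    (use assms(1,3) in \<open>simp add: boolean_witt_d\<close>)

lemma bij_betw_boolean_witt:
  assumes p: "prime p"
  shows "bij_betw (boolean_witt p) UNIV (witt p)"
  unfolding bij_betw_def
proof
  show "inj (boolean_witt p)"
  proof (rule injI)
    fix u v assume "boolean_witt p u = boolean_witt p v"
    then have "pattern u = pattern v"
      by (intro ext) (metis boolean_witt_d[OF p])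
    then show "u = v"
      by (rule pattern_inj)
  qed
  show "range (boolean_witt p) = witt p"
  proof
    show "witt p \<subseteq> range (boolean_witt p)"
    proof
      fix a :: "nat mps \<Rightarrow> bool"
      assume a: "a \<in> witt p"
      obtain u where "(\<lambda>i j. a (d p i j)) = pattern u"
        using is_pattern_classification[OF witt_pattern[OF p a]] by blast
      then have "boolean_witt p u = a"
        by (intro boolean_witt_eqI p a) metis
      then show "a \<in> range (boolean_witt p)"
        by blast
    qed
  qed (use boolean_witt_in_witt[OF p] in auto)
qed

lemma boolean_witt_le_iff:
  assumes "prime p"
  shows "witt_le p (boolean_witt p u) (boolean_witt p v) \<longleftrightarrow> u \<le> v"
  by (simp add: witt_le_iff boolean_witt_in_witt boolean_witt_d assms pattern_le_iff)


section \<open>Tensor products\<close>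

definition in_left :: "nat mps \<Rightarrow> (nat + nat) mps" where
  "in_left = msubst (\<lambda>i. Some {#Inl i#})"

definition in_right :: "nat mps \<Rightarrow> (nat + nat) mps" where
  "in_right = msubst (\<lambda>i. Some {#Inr i#})"

definition tensor_generators :: "nat \<Rightarrow> (nat + nat) mps set" where
  "tensor_generators p = {in_left (d p i j) | i j. True} \<union> {in_right (d p i j) | i j. True}"

abbreviation tensor_semiring :: "nat \<Rightarrow> (nat + nat) mps set" where
  "tensor_semiring p \<equiv> subsemiring_generated (tensor_generators p)"

lemma tensor_eq: "tensor f g = in_left f * in_right g"
  by (simp add: tensor_def in_left_def in_right_def)

lemma finite_fibres_in_left: "finite_fibres (\<lambda>i. Some {#Inl i#})"
  and finite_fibres_in_right: "finite_fibres (\<lambda>i. Some {#Inr i#})"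
  by (auto intro!: finite_fibres_inj injI)

lemma bounded_degree_variables:
  assumes "bounded_degree f"
  shows "bounded_degree (msubst (\<lambda>i. Some {#y i#}) f)"
proof -
  obtain n where n: "\<And>a. coeff f a \<noteq> 0 \<Longrightarrow> size a \<le> n"
    using assms by (auto simp: bounded_degree_def)
  have "size m \<le> n" if nz: "coeff (msubst (\<lambda>i. Some {#y i#}) f) m \<noteq> 0" for m
  proof -
    have "\<exists>a. coeff f a \<noteq> 0 \<and> monomial_subst (\<lambda>i. Some {#y i#}) a = Some m"
    proof (rule ccontr)
      assume "\<not> ?thesis"
      then have "coeff (msubst (\<lambda>i. Some {#y i#}) f) m = 0"
        unfolding coeff_msubst by (subst linear_ext_eq_sum[where A = "{}"]) auto
      with nz show False ..
    qed
    then obtain a where a: "coeff f a \<noteq> 0" "monomial_subst (\<lambda>i. Some {#y i#}) a = Some m"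
      by blast
    have "(\<Sum>i\<in>#a. {#y i#}) = image_mset y a"
      by (induction a) simp_all
    then have "size m = size a"
      using a(2) by (auto simp: monomial_subst_def split: if_splits)
    then show ?thesis
      using n a(1) by simp
  qed
  then show ?thesis
    unfolding bounded_degree_def by blast
qed

lemma bounded_degree_in_left: "bounded_degree f \<Longrightarrow> bounded_degree (in_left f)"
  and bounded_degree_in_right: "bounded_degree f \<Longrightarrow> bounded_degree (in_right f)"
  by (simp_all add: in_left_def in_right_def bounded_degree_variables)

lemma bounded_degree_tensor_semiring: "t \<in> tensor_semiring p \<Longrightarrow> bounded_degree t"
  by (erule bounded_degree_generated)
    (auto simp: tensor_generators_def bounded_degree_in_left bounded_degree_in_right bounded_degree_d)

lemma frob_in_left: "p > 0 \<Longrightarrow> bounded_degree f \<Longrightarrow> frob p (in_left f) = in_left (frob p f)"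
  and frob_in_right: "p > 0 \<Longrightarrow> bounded_degree f \<Longrightarrow> frob p (in_right f) = in_right (frob p f)"
  by (simp_all add: in_left_def in_right_def msubst_frob finite_fibres_in_left finite_fibres_in_right)

lemma is_delta_in_left:
  "is_delta p f h \<Longrightarrow> p > 0 \<Longrightarrow> bounded_degree f \<Longrightarrow> bounded_degree h \<Longrightarrow> is_delta p (in_left f) (in_left h)"
  and is_delta_in_right:
  "is_delta p f h \<Longrightarrow> p > 0 \<Longrightarrow> bounded_degree f \<Longrightarrow> bounded_degree h \<Longrightarrow> is_delta p (in_right f) (in_right h)"
  by (simp_all add: in_left_def in_right_def is_delta_msubst finite_fibres_in_left finite_fibres_in_right)

lemma in_left_d: "in_left (d p i j) \<in> tensor_semiring p"
  and in_right_d: "in_right (d p i j) \<in> tensor_semiring p"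
  by (auto intro!: subsemiring_generated.incl simp: tensor_generators_def)

lemma delta_closed_tensor_semiring:
  assumes p: "prime p" and t: "t \<in> tensor_semiring p"
  shows "frob p t \<in> tensor_semiring p \<and> (\<exists>h\<in>tensor_semiring p. is_delta p t h)"
proof (rule delta_closed_generated[OF p _ _ _ t])
  have p0: "p > 0"
    using p by (rule prime_gt_0_nat)
  fix g assume g: "g \<in> tensor_generators p"
  then show "bounded_degree g"
    by (intro bounded_degree_tensor_semiring subsemiring_generated.incl)
  from g obtain i j where "g = in_left (d p i j) \<or> g = in_right (d p i j)"
    by (auto simp: tensor_generators_def)
  moreover have "frob p (in_left (d p i j)) = in_left (d p i (Suc j))"
      "frob p (in_right (d p i j)) = in_right (d p i (Suc j))"
    by (simp_all add: frob_in_left frob_in_right p0 bounded_degree_d frob_d[OF p])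
  moreover have "is_delta p (in_left (d p i j)) (in_left (d p (Suc i) j))"
      "is_delta p (in_right (d p i j)) (in_right (d p (Suc i) j))"
    by (intro is_delta_in_left is_delta_in_right is_delta_d p p0 bounded_degree_d)+
  ultimately show "frob p g \<in> tensor_semiring p" "\<exists>h\<in>tensor_semiring p. is_delta p g h"
    using in_left_d in_right_d by metis+
qed

text \<open>
  The operations determine the image of all \<open>d\<^sub>i\<^sub>,\<^sub>j\<close> under a substitution from the image of
  \<open>d\<^sub>0\<^sub>,\<^sub>0\<close>, and they do not lead out of the tensor square.
\<close>

lemma msubst_in_tensor_semiring:
  assumes p: "prime p" and y: "finite_fibres y" and y1: "msubst y (power_sum 1) \<in> tensor_semiring p"
    and f: "f \<in> Lambda_typ p"
  shows "msubst y f \<in> tensor_semiring p"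
proof -
  have p0: "p > 0"
    using p by (rule prime_gt_0_nat)
  have d: "msubst y (d p i j) \<in> tensor_semiring p" for i j
  proof (induction i)
    case 0
    show ?case
    proof (induction j)
      case 0
      show ?case
        using y1 by (simp add: d_0[OF p0])
    next
      case (Suc j)
      have "msubst y (d p 0 (Suc j)) = frob p (msubst y (d p 0 j))"
        using msubst_frob[OF y bounded_degree_d p0, of p 0 j] by (simp add: frob_d[OF p])
      then show ?case
        using Suc delta_closed_tensor_semiring[OF p] by simp
    qed
  next
    case (Suc i)
    then obtain h where h: "h \<in> tensor_semiring p" "is_delta p (msubst y (d p i j)) h"
      using delta_closed_tensor_semiring[OF p] by blast
    have "is_delta p (msubst y (d p i j)) (msubst y (d p (Suc i) j))"
      by (intro is_delta_msubst is_delta_d p p0 y bounded_degree_d)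
    then show ?case
      using is_delta_unique[OF _ h(2) p0] h(1) by blast
  qed
  have bd: "bounded_degree f" if "f \<in> subsemiring_generated {d p i j | i j. True}" for f
    using that bounded_degree_Lambda_typ by (simp add: Lambda_typ_def)
  show ?thesis
    using f unfolding Lambda_typ_def
    by induction
      (auto simp: msubst_zero msubst_one msubst_add[OF y] msubst_mult[OF y] bd d
        intro: subsemiring_generated.intros(1,2,4,5))
qed

lemma tensor_semiring_pure_tensors:
  assumes "t \<in> tensor_semiring p"
  shows "\<exists>ts. set ts \<subseteq> Lambda_typ p \<times> Lambda_typ p \<and> t = (\<Sum>(f, g)\<leftarrow>ts. tensor f g)"
proof -
  let ?L = "Lambda_typ p"
  have L: "1 \<in> ?L" "\<And>f g. f \<in> ?L \<Longrightarrow> g \<in> ?L \<Longrightarrow> f * g \<in> ?L"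
    by (auto simp: Lambda_typ_def intro: subsemiring_generated.intros)
  have in_one: "in_left 1 = 1" "in_right 1 = 1"
    by (simp_all add: in_left_def in_right_def msubst_one)
  have times: "tensor (f * f') (g * g') = tensor f g * tensor f' g'"
    if "f \<in> ?L" "f' \<in> ?L" "g \<in> ?L" "g' \<in> ?L" for f f' g g'
    using that by (simp add: tensor_eq in_left_def in_right_def msubst_mult finite_fibres_in_left
        finite_fibres_in_right bounded_degree_Lambda_typ mult_ac)
  have times1: "\<exists>us. set us \<subseteq> ?L \<times> ?L \<and> tensor f g * (\<Sum>(f, g)\<leftarrow>ts. tensor f g) = (\<Sum>(f, g)\<leftarrow>us. tensor f g)"
    if ts: "set ts \<subseteq> ?L \<times> ?L" and fg: "f \<in> ?L" "g \<in> ?L" for ts f g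
    using ts
  proof (induction ts)
    case Nil
    show ?case
      by (rule exI[of _ "[]"]) simp
  next
    case (Cons h ts)
    obtain f' g' where h: "h = (f', g')"
      by (cases h)
    obtain us where us: "set us \<subseteq> ?L \<times> ?L"
        "tensor f g * (\<Sum>(f, g)\<leftarrow>ts. tensor f g) = (\<Sum>(f, g)\<leftarrow>us. tensor f g)"
      using Cons by auto
    show ?case
      by (rule exI[of _ "(f * f', g * g') # us"])
        (use Cons.prems fg us L in \<open>auto simp: h times distrib_left\<close>)
  qed
  have times2: "\<exists>vs. set vs \<subseteq> ?L \<times> ?L \<and>
      (\<Sum>(f, g)\<leftarrow>ts. tensor f g) * (\<Sum>(f, g)\<leftarrow>us. tensor f g) = (\<Sum>(f, g)\<leftarrow>vs. tensor f g)"
    if ts: "set ts \<subseteq> ?L \<times> ?L" and us: "set us \<subseteq> ?L \<times> ?L" for ts us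
    using ts
  proof (induction ts)
    case Nil
    show ?case
      by (rule exI[of _ "[]"]) simp
  next
    case (Cons h ts)
    obtain f g where h: "h = (f, g)"
      by (cases h)
    obtain vs where vs: "set vs \<subseteq> ?L \<times> ?L"
        "(\<Sum>(f, g)\<leftarrow>ts. tensor f g) * (\<Sum>(f, g)\<leftarrow>us. tensor f g) = (\<Sum>(f, g)\<leftarrow>vs. tensor f g)"
      using Cons by auto
    obtain ws where ws: "set ws \<subseteq> ?L \<times> ?L"
        "tensor f g * (\<Sum>(f, g)\<leftarrow>us. tensor f g) = (\<Sum>(f, g)\<leftarrow>ws. tensor f g)"
      using times1[OF us, of f g] Cons.prems h by auto
    show ?case
      by (rule exI[of _ "ws @ vs"]) (use vs ws in \<open>auto simp: h distrib_right\<close>)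
  qed
  show ?thesis
    using assms
  proof induction
    case zero
    show ?case
      by (rule exI[of _ "[]"]) simp
  next
    case one
    show ?case
      by (rule exI[of _ "[(1, 1)]"]) (simp add: L tensor_eq in_one)
  next
    case (incl t)
    then obtain i j where "t = tensor (d p i j) 1 \<or> t = tensor 1 (d p i j)"
      by (auto simp: tensor_generators_def tensor_eq in_one)
    then show ?case
      using L(1) d_in_Lambda_typ
      by (elim disjE; intro exI[of _ "[(d p i j, 1)]"] exI[of _ "[(1, d p i j)]"]) auto
  next
    case (add t s)
    then obtain ts us where "set ts \<subseteq> ?L \<times> ?L" "t = (\<Sum>(f, g)\<leftarrow>ts. tensor f g)"
        "set us \<subseteq> ?L \<times> ?L" "s = (\<Sum>(f, g)\<leftarrow>us. tensor f g)"
      by blast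
    then show ?case
      by (intro exI[of _ "ts @ us"]) auto
  next
    case (mult t s)
    then obtain ts us where "set ts \<subseteq> ?L \<times> ?L" "t = (\<Sum>(f, g)\<leftarrow>ts. tensor f g)"
        "set us \<subseteq> ?L \<times> ?L" "s = (\<Sum>(f, g)\<leftarrow>us. tensor f g)"
      by blast
    then show ?case
      using times2 by blast
  qed
qed

definition join :: "(nat \<Rightarrow> nat \<Rightarrow> complex) \<Rightarrow> (nat \<Rightarrow> nat \<Rightarrow> complex) \<Rightarrow> nat \<Rightarrow> nat + nat \<Rightarrow> complex" where
  "join x y N = case_sum (x N) (y N)"

lemma finitely_supported_join:
  assumes "finitely_supported (x N)" "finitely_supported (y N)"
  shows "finitely_supported (join x y N)"
proof -
  have "{s. join x y N s \<noteq> 0} \<subseteq> Inl ` {i. x N i \<noteq> 0} \<union> Inr ` {i. y N i \<noteq> 0}"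
  proof
    fix s assume "s \<in> {s. join x y N s \<noteq> 0}"
    then show "s \<in> Inl ` {i. x N i \<noteq> 0} \<union> Inr ` {i. y N i \<noteq> 0}"
      by (cases s) (auto simp: join_def)
  qed
  then show ?thesis
    using assms unfolding finitely_supported_def by (auto dest: finite_subset)
qed

lemma value_at_join:
  assumes "bounded_degree f" "finitely_supported (x N)" "finitely_supported (y N)"
  shows "value_at (join x y N) (in_left f) = value_at (x N) f"
    and "value_at (join x y N) (in_right f) = value_at (y N) f"
  unfolding in_left_def in_right_def
  by (rule value_at_msubst; use assms in \<open>simp add: join_def\<close>)+

lemma realizes_join:
  assumes "bounded_degree f" "\<And>N. finitely_supported (x N)" "\<And>N. finitely_supported (y N)"
  shows "realizes (join x y) (in_left f) b \<longleftrightarrow> realizes x f b"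
    and "realizes (join x y) (in_right f) b \<longleftrightarrow> realizes y f b"
  using assms by (simp_all add: realizes_def value_at_join)

text \<open>
  By nonnegativity, the Boolean value of a sum of pure tensors depends only on its value at
  suitable points, hence not on the representation.
\<close>

lemma tensor_eval_realized:
  fixes a b :: "nat mps \<Rightarrow> bool"
  assumes x: "\<And>N. finitely_supported (x N)" "\<And>f. f \<in> Lambda_typ p \<Longrightarrow> realizes x f (a f)"
    and y: "\<And>N. finitely_supported (y N)" "\<And>f. f \<in> Lambda_typ p \<Longrightarrow> realizes y f (b f)"
    and t: "t \<in> tensor_semiring p"
  shows "realizes (join x y) t (tensor_eval (Lambda_typ p) a b t)"
proof -
  let ?L = "Lambda_typ p"
  have xy: "finitely_supported (join x y N)" for N
    by (intro finitely_supported_join x y)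
  have sum: "realizes (join x y) (\<Sum>(f, g)\<leftarrow>ts. tensor f g) (\<Sum>(f, g)\<leftarrow>ts. a f * b g) \<and>
      bounded_degree (\<Sum>(f, g)\<leftarrow>ts. tensor f g)"
    if "set ts \<subseteq> ?L \<times> ?L" for ts
    using that
  proof (induction ts)
    case Nil
    show ?case
      using realizes_zero by (simp add: zero_bool_def bounded_degree_zero)
  next
    case (Cons h ts)
    obtain f g where h: "h = (f, g)" "f \<in> ?L" "g \<in> ?L"
      using Cons.prems by auto
    have bd: "bounded_degree f" "bounded_degree g"
      using h bounded_degree_Lambda_typ by blast+
    have "realizes (join x y) (tensor f g) (a f \<and> b g)"
      unfolding tensor_eq
      by (intro realizes_mult xy bounded_degree_in_left bounded_degree_in_right bd)
        (simp_all add: realizes_join bd x y h)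
    moreover have bdt: "bounded_degree (tensor f g)"
      unfolding tensor_eq by (intro bounded_degree_mult bounded_degree_in_left bounded_degree_in_right bd)
    ultimately show ?case
      using Cons realizes_add[of "join x y" "tensor f g" "a f \<and> b g", OF _ _ _ _ xy]
      by (auto simp: h plus_bool_def times_bool_def intro: bounded_degree_add)
  qed
  obtain ts where ts: "set ts \<subseteq> ?L \<times> ?L" "t = (\<Sum>(f, g)\<leftarrow>ts. tensor f g)"
    using tensor_semiring_pure_tensors[OF t] by blast
  have "tensor_eval ?L a b t = (\<Sum>(f, g)\<leftarrow>ts. a f * b g)"
    unfolding tensor_eval_def
  proof (rule the_equality)
    fix c assume "\<exists>ts. set ts \<subseteq> ?L \<times> ?L \<and> t = (\<Sum>(f, g)\<leftarrow>ts. tensor f g) \<and> c = (\<Sum>(f, g)\<leftarrow>ts. a f * b g)"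
    then show "c = (\<Sum>(f, g)\<leftarrow>ts. a f * b g)"
      using sum ts realizes_unique by metis
  qed (use ts in blast)
  then show ?thesis
    using sum[OF ts(1)] ts(2) by simp
qed


section \<open>Sums and products of generators\<close>

lemma coeff_msubst_injective:
  assumes "inj c"
  shows "coeff (msubst (\<lambda>i. Some (c i)) (power_sum 1)) m = of_bool (m \<in> range c)"
proof -
  have "card {i. Some (c i) = Some m} = of_bool (m \<in> range c)"
  proof (cases "m \<in> range c")
    case True
    then obtain i where "m = c i"
      by blast
    then have "{i. Some (c i) = Some m} = {i}"
      using assms by (auto dest: injD)
    then show ?thesis
      using True by simp
  next
    case False
    then have "{i. Some (c i) = Some m} = {}"
      by auto
    then show ?thesis
      using False by simp
  qed
  then show ?thesis
    by (simp only: coeff_msubst_power_sum_1[OF finite_fibres_inj[OF assms]]) simp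
qed

lemma finite_fibres_Delta_plus: "finite_fibres (\<lambda>n. Some {#sum_decode n#})"
  by (intro finite_fibres_inj injI) (simp add: inj_eq[OF inj_sum_decode])

definition pair_monomial :: "nat \<Rightarrow> (nat + nat) multiset" where
  "pair_monomial n = (case prod_decode n of (i, j) \<Rightarrow> {#Inl i, Inr j#})"

lemma inj_pair_monomial: "inj pair_monomial"
proof (rule injI)
  fix m n assume "pair_monomial m = pair_monomial n"
  then have "prod_decode m = prod_decode n"
    by (cases "prod_decode m"; cases "prod_decode n")
      (auto simp: pair_monomial_def add_eq_conv_ex simp del: prod_decode_eq)
  then show "m = n"
    by (simp add: inj_eq[OF inj_prod_decode])
qed

lemma range_pair_monomial: "range pair_monomial = {{#Inl i, Inr j#} | i j. True}"
proof
  show "{{#Inl i, Inr j#} | i j. True} \<subseteq> range pair_monomial"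
  proof clarify
    fix i j
    have "{#Inl i, Inr j#} = pair_monomial (prod_encode (i, j))"
      by (simp add: pair_monomial_def)
    then show "{#Inl i, Inr j#} \<in> range pair_monomial"
      by blast
  qed
  show "range pair_monomial \<subseteq> {{#Inl i, Inr j#} | i j. True}"
    unfolding pair_monomial_def case_prod_beta by blast
qed

lemma Delta_times_eq: "Delta_times = msubst (\<lambda>n. Some (pair_monomial n))"
  by (simp add: Delta_times_def pair_monomial_def case_prod_beta)

lemma finite_fibres_Delta_times: "finite_fibres (\<lambda>n. Some (pair_monomial n))"
  by (rule finite_fibres_inj[OF inj_pair_monomial])

lemma coeff_in_left_power_sum_1: "coeff (in_left (power_sum 1)) m = of_bool (\<exists>i. m = {#Inl i#})"
  unfolding in_left_def by (subst coeff_msubst_injective) (auto intro: injI)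

lemma coeff_in_right_power_sum_1: "coeff (in_right (power_sum 1)) m = of_bool (\<exists>i. m = {#Inr i#})"
  unfolding in_right_def by (subst coeff_msubst_injective) (auto intro: injI)

lemma Delta_plus_power_sum_1: "Delta_plus (power_sum 1) = in_left (power_sum 1) + in_right (power_sum 1)"
proof (rule mps_eqI)
  fix m :: "(nat + nat) multiset"
  have "(m \<in> range (\<lambda>n. {#sum_decode n#})) \<longleftrightarrow> (\<exists>s. m = {#s#})"
    by (metis (no_types, lifting) rangeE rangeI surjD surj_sum_decode)
  moreover have "(\<exists>s. m = {#s#}) \<longleftrightarrow> (\<exists>i. m = {#Inl i#}) \<or> (\<exists>i. m = {#Inr i#})"
    by (metis sum.exhaust)
  moreover have "\<not> ((\<exists>i. m = {#Inl i#}) \<and> (\<exists>i. m = {#Inr i#}))"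
    by auto
  moreover have "inj (\<lambda>n. {#sum_decode n#})"
    by (intro injI) (simp add: inj_eq[OF inj_sum_decode])
  ultimately show "coeff (Delta_plus (power_sum 1)) m = coeff (in_left (power_sum 1) + in_right (power_sum 1)) m"
    unfolding Delta_plus_def plus_mps_def coeff_Mps coeff_in_left_power_sum_1 coeff_in_right_power_sum_1
    by (subst coeff_msubst_injective) auto
qed

lemma Delta_times_power_sum_1: "Delta_times (power_sum 1) = in_left (power_sum 1) * in_right (power_sum 1)"
proof (rule mps_eqI)
  fix m :: "(nat + nat) multiset"
  let ?t = "\<lambda>a. of_bool (\<exists>i. a = {#Inl i#}) * of_bool (\<exists>j. m - a = {#Inr j#}) :: int"
  have "(\<Sum>a | a \<subseteq># m. ?t a) = of_bool (m \<in> range pair_monomial)"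
  proof (cases "m \<in> range pair_monomial")
    case True
    then obtain i j where m: "m = {#Inl i, Inr j#}"
      unfolding range_pair_monomial by blast
    have "(\<Sum>a | a \<subseteq># m. ?t a) = (\<Sum>a\<in>{{#Inl i#}}. ?t a)"
    proof (rule sum.mono_neutral_right)
      show "\<forall>a\<in>{a. a \<subseteq># m} - {{#Inl i#}}. ?t a = 0"
      proof
        fix a assume a: "a \<in> {a. a \<subseteq># m} - {{#Inl i#}}"
        have "a \<noteq> {#Inl k#}" for k
          using a by (auto simp: m)
        then show "?t a = 0"
          by simp
      qed
    qed (auto simp: finite_submultisets m)
    also have "\<dots> = 1"
      by (simp add: m)
    finally show ?thesis
      using True by simp
  next
    case False
    have "?t a = 0" if "a \<subseteq># m" for a
    proof (rule ccontr)
      assume "?t a \<noteq> 0"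
      then obtain i j where "a = {#Inl i#}" "m - a = {#Inr j#}"
        by (auto split: if_splits)
      then have "m = {#Inl i, Inr j#}"
        using that by (metis add_mset_add_single subset_mset.diff_add union_mset_add_mset_left add.left_neutral)
      then show False
        using False unfolding range_pair_monomial by blast
    qed
    then have "(\<Sum>a | a \<subseteq># m. ?t a) = 0"
      by (intro sum.neutral) blast
    then show ?thesis
      using False by simp
  qed
  then show "coeff (Delta_times (power_sum 1)) m = coeff (in_left (power_sum 1) * in_right (power_sum 1)) m"
    unfolding Delta_times_eq coeff_msubst_injective[OF inj_pair_monomial]
    by (simp add: times_mps_def coeff_in_left_power_sum_1[unfolded One_nat_def]
        coeff_in_right_power_sum_1[unfolded One_nat_def])
qed

lemma Delta_frob:
  assumes "p > 0" "bounded_degree f"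
  shows "Delta_plus (frob p f) = frob p (Delta_plus f)"
    and "Delta_times (frob p f) = frob p (Delta_times f)"
  using assms by (simp_all add: Delta_plus_def Delta_times_eq msubst_frob finite_fibres_Delta_plus
      finite_fibres_Delta_times)

lemma Delta_d_0:
  assumes p: "prime p"
  shows "Delta_plus (d p 0 j) = in_left (d p 0 j) + in_right (d p 0 j)"
    and "Delta_times (d p 0 j) = in_left (d p 0 j) * in_right (d p 0 j)"
proof -
  have p0: "p > 0"
    using p by (rule prime_gt_0_nat)
  note bd = bounded_degree_in_left[OF bounded_degree_d] bounded_degree_in_right[OF bounded_degree_d]
  note frob_in = frob_in_left[OF p0 bounded_degree_d] frob_in_right[OF p0 bounded_degree_d] frob_d[OF p]
  have "Delta_plus (d p 0 j) = in_left (d p 0 j) + in_right (d p 0 j) \<and>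
      Delta_times (d p 0 j) = in_left (d p 0 j) * in_right (d p 0 j)"
  proof (induction j)
    case 0
    show ?case
      using Delta_plus_power_sum_1 Delta_times_power_sum_1 by (simp add: d_0[OF p0])
  next
    case (Suc j)
    then show ?case
      using Delta_frob[OF p0 bounded_degree_d, of p 0 j]
        frob_add[OF p0 bd, of p 0 j p 0 j] frob_mult[OF p0 bd, of p 0 j p 0 j]
      by (simp add: frob_in)
  qed
  then show "Delta_plus (d p 0 j) = in_left (d p 0 j) + in_right (d p 0 j)"
    and "Delta_times (d p 0 j) = in_left (d p 0 j) * in_right (d p 0 j)"
    by blast+
qed

lemma is_delta_Delta:
  assumes p: "prime p"
  shows "is_delta p (Delta_plus (d p i j)) (Delta_plus (d p (Suc i) j))"
    and "is_delta p (Delta_times (d p i j)) (Delta_times (d p (Suc i) j))"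
  unfolding Delta_plus_def Delta_times_eq
  by (intro is_delta_msubst is_delta_d p prime_gt_0_nat bounded_degree_d finite_fibres_Delta_plus
      finite_fibres_Delta_times)+

lemma Delta_in_tensor_semiring:
  assumes p: "prime p" and f: "f \<in> Lambda_typ p"
  shows "Delta_plus f \<in> tensor_semiring p" "Delta_times f \<in> tensor_semiring p"
proof -
  have "in_left (power_sum 1) \<in> tensor_semiring p" "in_right (power_sum 1) \<in> tensor_semiring p"
    using in_left_d[of p 0 0] in_right_d[of p 0 0] by (simp_all add: d_0 prime_gt_0_nat[OF p])
  then have "Delta_plus (power_sum 1) \<in> tensor_semiring p" "Delta_times (power_sum 1) \<in> tensor_semiring p"
    unfolding Delta_plus_power_sum_1 Delta_times_power_sum_1
    by (auto intro: subsemiring_generated.intros)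
  then show "Delta_plus f \<in> tensor_semiring p" "Delta_times f \<in> tensor_semiring p"
    unfolding Delta_plus_def Delta_times_eq
    using msubst_in_tensor_semiring[OF p _ _ f] finite_fibres_Delta_plus finite_fibres_Delta_times
    by blast+
qed

lemma value_at_Delta_plus:
  assumes "finitely_supported x" "bounded_degree f"
  shows "value_at x (Delta_plus f) = value_at (\<lambda>n. x (sum_decode n)) f"
    and "finitely_supported (\<lambda>n. x (sum_decode n))"
proof -
  show fin: "finitely_supported (\<lambda>n. x (sum_decode n))"
    using assms(1) finite_vimageI[of "{s. x s \<noteq> 0}" sum_decode] inj_sum_decode
    by (simp add: finitely_supported_def vimage_def)
  show "value_at x (Delta_plus f) = value_at (\<lambda>n. x (sum_decode n)) f"
    unfolding Delta_plus_def by (rule value_at_msubst[OF assms(2) fin]) simp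
qed

lemma value_at_Delta_times:
  assumes "finitely_supported x" "bounded_degree f"
  shows "value_at x (Delta_times f) = value_at (\<lambda>n. \<Prod>k\<in>#pair_monomial n. x k) f"
    and "finitely_supported (\<lambda>n. \<Prod>k\<in>#pair_monomial n. x k)"
proof -
  let ?S = "{s. x s \<noteq> 0}"
  have "{n. (\<Prod>k\<in>#pair_monomial n. x k) \<noteq> 0} \<subseteq> pair_monomial -` {m. set_mset m \<subseteq> ?S \<and> size m \<le> 2}"
    by (auto simp: pair_monomial_def split: prod.splits)
  moreover have "finite (pair_monomial -` {m. set_mset m \<subseteq> ?S \<and> size m \<le> 2})"
    using assms(1) by (intro finite_vimageI inj_pair_monomial finite_multisets_bounded)
      (simp add: finitely_supported_def)
  ultimately show fin: "finitely_supported (\<lambda>n. \<Prod>k\<in>#pair_monomial n. x k)"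
    unfolding finitely_supported_def by (rule finite_subset)
  show "value_at x (Delta_times f) = value_at (\<lambda>n. \<Prod>k\<in>#pair_monomial n. x k) f"
    unfolding Delta_times_eq by (rule value_at_msubst[OF assms(2) fin]) simp
qed

text \<open>
  This is where \<open>p > 2\<close> enters. If \<open>f\<close> and \<open>g\<close> have the Boolean value 1 then so
  have \<open>f g ^ (p - 1)\<close> and \<open>f ^ 2 g ^ (p - 2)\<close>, which occur in the image of \<open>f + g\<close>
  under the operation; so this is again a sum of two elements with value 1. For \<open>p = 2\<close> only
  \<open>f g\<close> occurs.
\<close>

lemma is_delta_two_terms:
  assumes p: "prime p" "p > 2" and x: "\<And>N. finitely_supported (x N)"
    and R: "\<And>t. t \<in> tensor_semiring p \<Longrightarrow> \<exists>b. realizes x t b"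
    and f: "f \<in> tensor_semiring p" "realizes x f True"
    and g: "g \<in> tensor_semiring p" "realizes x g True"
    and t: "is_delta p (f + g) t"
  shows "\<exists>f' g'. f' \<in> tensor_semiring p \<and> realizes x f' True \<and>
    g' \<in> tensor_semiring p \<and> realizes x g' True \<and> t = f' + g'"
proof -
  let ?T = "tensor_semiring p"
  obtain h where h: "h \<in> ?T" "is_delta p f h"
    using delta_closed_tensor_semiring[OF p(1) f(1)] by blast
  obtain k where k: "k \<in> ?T" "is_delta p g k"
    using delta_closed_tensor_semiring[OF p(1) g(1)] by blast
  define c where "c = (\<lambda>i. of_nat ((p choose i) div p) * f ^ i * g ^ (p - i))"
  define r where "r = h + k + (\<Sum>i\<in>{3..<p}. c i)"
  have c: "c i \<in> ?T" for i
    unfolding c_def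
    by (intro subsemiring_generated.mult generated_of_nat generated_power f g)
  have r: "r \<in> ?T"
    unfolding r_def by (intro subsemiring_generated.add generated_sum h k c)
  have c_True: "realizes x (c i) True" if i: "1 \<le> i" "i < p" for i
  proof -
    have "p dvd (p choose i)"
      using i p by (intro dvd_choose_prime) auto
    moreover have "p choose i > 0"
      using i by simp
    ultimately have "(p choose i) div p > 0"
      using dvd_imp_le div_greater_zero_iff p(2) by auto
    then have "realizes x (of_nat ((p choose i) div p)) True"
      using realizes_of_nat[OF x, where n = "(p choose i) div p"] by simp
    moreover have "realizes x (f ^ i) True" "realizes x (g ^ (p - i)) True"
      using f g x i by (auto intro!: realizes_power bounded_degree_tensor_semiring)
    ultimately show ?thesis
      unfolding c_def
      using realizes_mult[OF realizes_mult[of x _ True _ True] _ _ _ x, of _ _ _ True]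
        bounded_degree_tensor_semiring f(1) g(1) x
      by (simp add: bounded_degree_mult bounded_degree_of_nat bounded_degree_power)
  qed
  have t_eq: "t = h + k + (\<Sum>i\<in>{1..<p}. c i)"
    using is_delta_unique[OF t is_delta_add[OF p(1) h(2) _ k(2)]] f g p
    by (simp add: c_def bounded_degree_tensor_semiring)
  have "{1..<p} = insert 1 (insert 2 {3..<p})"
    using p(2) by auto
  then have "t = c 1 + (c 2 + r)"
    unfolding t_eq r_def by (simp add: add_ac)
  moreover obtain b where "realizes x r b"
    using R[OF r] by blast
  then have "realizes x (c 2 + r) True"
    using realizes_add[OF c_True[of 2] _ bounded_degree_tensor_semiring[OF c]
        bounded_degree_tensor_semiring[OF r] x] p(2) by simp
  ultimately show ?thesis
    using c_True[of 1] p(2) c r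
    by (intro exI[of _ "c 1"] exI[of _ "c 2 + r"]) (simp add: subsemiring_generated.add)
qed

lemma is_delta_two_terms_iterate:
  assumes p: "prime p" "p > 2" and x: "\<And>N. finitely_supported (x N)"
    and R: "\<And>t. t \<in> tensor_semiring p \<Longrightarrow> \<exists>b. realizes x t b"
    and f: "f \<in> tensor_semiring p" "realizes x f True"
    and g: "g \<in> tensor_semiring p" "realizes x g True"
    and s: "s 0 = f + g" "\<And>n. is_delta p (s n) (s (Suc n))"
  shows "realizes x (s n) True"
proof -
  have "\<exists>f g. f \<in> tensor_semiring p \<and> realizes x f True \<and>
    g \<in> tensor_semiring p \<and> realizes x g True \<and> s n = f + g"
  proof (induction n)
    case 0
    show ?case
      using f g s(1) by blast
  next
    case (Suc n)
    then obtain f g where fg: "f \<in> tensor_semiring p" "realizes x f True"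
        "g \<in> tensor_semiring p" "realizes x g True" "s n = f + g"
      by blast
    then show ?case
      using is_delta_two_terms[OF p x R fg(1-4)] s(2)[of n] by metis
  qed
  then obtain f g where fg: "f \<in> tensor_semiring p" "realizes x f True"
      "g \<in> tensor_semiring p" "realizes x g True" "s n = f + g"
    by blast
  then show ?thesis
    using realizes_add[OF fg(2,4) _ _ x] by (simp add: bounded_degree_tensor_semiring)
qed

text \<open>
  The element \<open>d\<^sub>i\<^sub>,\<^sub>j\<close> is homogeneous of degree \<open>p ^ (i + j)\<close> and a rational polynomial in
  the \<open>d\<^sub>0\<^sub>,\<^sub>j'\<close> with \<open>j' \<ge> j\<close>, so that rescaling these by the powers of a number rescales it as well.
\<close>

lemma eventually_d_scaled:
  fixes x z :: "nat \<Rightarrow> nat \<Rightarrow> complex"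
  assumes p: "prime p" and x: "\<And>N. finitely_supported (x N)" and z: "\<And>N. finitely_supported (z N)"
    and 0: "\<And>j'. j' \<ge> j \<Longrightarrow> \<forall>\<^sub>F N in sequentially.
      value_at (z N) (d p 0 j') = value_at (x N) (d p 0 j') * \<rho> N ^ (p ^ (j' - j))"
    and j': "j' \<ge> j"
  shows "\<forall>\<^sub>F N in sequentially.
      value_at (z N) (d p i j') = value_at (x N) (d p i j') * \<rho> N ^ (p ^ (i + j' - j))"
  using j'
proof (induction i arbitrary: j')
  case 0
  then show ?case
    using assms(4) by simp
next
  case (Suc i)
  have j': "Suc j' \<ge> j"
    using Suc.prems by simp
  show ?case
    using Suc.IH[OF Suc.prems] Suc.IH[OF j']
  proof eventually_elim
    case (elim N)
    have "i + Suc j' - j = Suc (i + j' - j)" "Suc i + j' - j = Suc (i + j' - j)"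
      using Suc.prems by simp_all
    then show ?case
      using elim
      by (simp add: value_at_d_Suc[OF p x] value_at_d_Suc[OF p z] power_mult_distrib
          diff_divide_distrib left_diff_distrib right_diff_distrib mult_ac flip: power_mult)
  qed
qed

lemma realizes_d_scaled:
  fixes x z :: "nat \<Rightarrow> nat \<Rightarrow> complex"
  assumes p: "prime p" and x: "\<And>N. finitely_supported (x N)" and z: "\<And>N. finitely_supported (z N)"
    and 0: "\<And>j'. j' \<ge> j \<Longrightarrow> \<forall>\<^sub>F N in sequentially.
      value_at (z N) (d p 0 j') = value_at (x N) (d p 0 j') * \<rho> N ^ (p ^ (j' - j))"
    and \<rho>: "\<forall>\<^sub>F N in sequentially. \<rho> N \<noteq> 0 \<longleftrightarrow> c"
    and xb: "realizes x (d p i j) b" and ze: "realizes z (d p i j) e"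
  shows "e \<longleftrightarrow> b \<and> c"
proof -
  have "\<forall>\<^sub>F N in sequentially.
      value_at (z N) (d p i j) = value_at (x N) (d p i j) * \<rho> N ^ (p ^ (i + j - j))"
    by (rule eventually_d_scaled[OF p x z]) (use 0 in auto)
  then have "\<forall>\<^sub>F N in sequentially. e \<longleftrightarrow> b \<and> c"
    using \<rho>
      xb[unfolded realizes_def] ze[unfolded realizes_def]
    by eventually_elim (use prime_gt_0_nat[OF p] in auto)
  then show ?thesis
    by simp
qed


section \<open>The semiring structure\<close>

lemma witt_realization:
  assumes p: "prime p" and a: "a \<in> witt p"
  obtains x :: "nat \<Rightarrow> nat \<Rightarrow> complex" where "\<And>N. finitely_supported (x N)"
    and "\<And>f. f \<in> Lambda_typ p \<Longrightarrow> realizes x f (a f)"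
  using exists_realization[OF p witt_pattern[OF p a]] witt_realized[OF _ a] by metis

lemma witt_antimono:
  assumes "prime p" "a \<in> witt p" "a (d p i' j')" "i \<le> i'" "j \<le> j'"
  shows "a (d p i j)"
  using is_pattern_mono[OF witt_pattern[OF assms(1,2)] assms(3-5)] .

text \<open>
  If one of \<open>a\<close> and \<open>b\<close> vanishes on \<open>d\<^sub>0\<^sub>,\<^sub>j\<close> then it vanishes on all \<open>d\<^sub>i\<^sub>,\<^sub>j'\<close> with
  \<open>j' \<ge> j\<close>, so that in this range it behaves as zero and the sum agrees with the other one.
  If neither does then \<open>d\<^sub>0\<^sub>,\<^sub>j\<close> goes to a sum of two nonzero terms, and
  all \<open>d\<^sub>i\<^sub>,\<^sub>j\<close> have the value 1.
\<close>

lemma witt_add_in_witt_and_d: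
  fixes a b :: "nat mps \<Rightarrow> bool"
  assumes p: "prime p" "p > 2" and a: "a \<in> witt p" and b: "b \<in> witt p"
  shows "witt_add p a b \<in> witt p"
    and "witt_add p a b (d p i j) \<longleftrightarrow> a (d p i j) \<or> b (d p i j) \<or> (a (d p 0 j) \<and> b (d p 0 j))"
proof -
  obtain x where x: "\<And>N. finitely_supported (x N)" "\<And>f. f \<in> Lambda_typ p \<Longrightarrow> realizes x f (a f)"
    using witt_realization[OF p(1) a] by blast
  obtain y where y: "\<And>N. finitely_supported (y N)" "\<And>f. f \<in> Lambda_typ p \<Longrightarrow> realizes y f (b f)"
    using witt_realization[OF p(1) b] by blast
  define c where "c = witt_add p a b"
  define z where "z = (\<lambda>N n. join x y N (sum_decode n))"
  have xy: "finitely_supported (join x y N)" for N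
    by (intro finitely_supported_join x y)
  have z: "finitely_supported (z N)" for N
    unfolding z_def by (rule value_at_Delta_plus(2)[OF xy bounded_degree_zero])
  have xy_c: "realizes (join x y) (Delta_plus f) (c f)" if "f \<in> Lambda_typ p" for f
    using tensor_eval_realized[OF x y Delta_in_tensor_semiring(1)[OF p(1) that]] that
    by (simp add: c_def witt_add_def)
  have z_c: "realizes z f (c f)" if f: "f \<in> Lambda_typ p" for f
    using xy_c[OF f] by (simp add: realizes_def z_def value_at_Delta_plus(1)[OF xy bounded_degree_Lambda_typ[OF f]])
  show "witt_add p a b \<in> witt p"
    unfolding c_def[symmetric]
  proof (rule witt_by_realization[OF z _ z_c])
    show "c \<in> extensional (Lambda_typ p)"
      by (simp only: c_def witt_add_def restrict_extensional)
  qed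
  have z_0: "value_at (z N) (d p 0 j) = value_at (x N) (d p 0 j) + value_at (y N) (d p 0 j)" for N j
    unfolding z_def value_at_Delta_plus(1)[OF xy bounded_degree_d, symmetric] Delta_d_0(1)[OF p(1)]
    by (simp add: value_at_add xy bounded_degree_in_left bounded_degree_in_right bounded_degree_d
        value_at_join x y)
  have vanish: "\<forall>\<^sub>F N in sequentially. value_at (w N) (d p 0 j') = 0"
    if "e \<in> witt p" "\<not> e (d p 0 j)" "j' \<ge> j" "\<And>f. f \<in> Lambda_typ p \<Longrightarrow> realizes w f (e f)"
    for w :: "nat \<Rightarrow> nat \<Rightarrow> complex" and e j'
  proof -
    have "\<not> e (d p 0 j')"
      using witt_antimono[OF p(1) that(1), of 0 j' 0 j] that by auto
    then show ?thesis
      using that(4)[OF d_in_Lambda_typ, of 0 j'] unfolding realizes_def by (auto elim: eventually_mono)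
  qed
  show "witt_add p a b (d p i j) \<longleftrightarrow> a (d p i j) \<or> b (d p i j) \<or> (a (d p 0 j) \<and> b (d p 0 j))"
  proof -
    consider (b) "\<not> b (d p 0 j)" | (a) "\<not> a (d p 0 j)" | (ab) "a (d p 0 j)" "b (d p 0 j)"
      by blast
    then show ?thesis
    proof cases
      case b
      have "c (d p i j) \<longleftrightarrow> a (d p i j) \<and> True"
      proof (rule realizes_d_scaled[OF p(1) x(1) z, where i = i and \<rho> = "\<lambda>_. 1"])
        show "\<forall>\<^sub>F N in sequentially. value_at (z N) (d p 0 j') =
            value_at (x N) (d p 0 j') * 1 ^ (p ^ (j' - j))" if "j' \<ge> j" for j'
        proof -
          have "\<forall>\<^sub>F N in sequentially. value_at (y N) (d p 0 j') = 0"
            by (rule vanish[OF \<open>b \<in> witt p\<close> b that y(2)])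
          then show ?thesis
            by eventually_elim (simp add: z_0)
        qed
      qed (simp_all add: x(2) z_c d_in_Lambda_typ)
      moreover have "\<not> b (d p i j)"
        using b witt_antimono[OF p(1) \<open>b \<in> witt p\<close>, of i j 0 j] by auto
      ultimately show ?thesis
        using b by (simp add: c_def)
    next
      case a
      have "c (d p i j) \<longleftrightarrow> b (d p i j) \<and> True"
      proof (rule realizes_d_scaled[OF p(1) y(1) z, where i = i and \<rho> = "\<lambda>_. 1"])
        show "\<forall>\<^sub>F N in sequentially. value_at (z N) (d p 0 j') =
            value_at (y N) (d p 0 j') * 1 ^ (p ^ (j' - j))" if "j' \<ge> j" for j'
        proof -
          have "\<forall>\<^sub>F N in sequentially. value_at (x N) (d p 0 j') = 0"
            by (rule vanish[OF \<open>a \<in> witt p\<close> a that x(2)])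
          then show ?thesis
            by eventually_elim (simp add: z_0)
        qed
      qed (simp_all add: y(2) z_c d_in_Lambda_typ)
      moreover have "\<not> a (d p i j)"
        using a witt_antimono[OF p(1) \<open>a \<in> witt p\<close>, of i j 0 j] by auto
      ultimately show ?thesis
        using a by (simp add: c_def)
    next
      case ab
      have "realizes (join x y) (Delta_plus (d p i j)) True"
      proof (rule is_delta_two_terms_iterate[OF p xy, where s = "\<lambda>i. Delta_plus (d p i j)"])
        show "\<exists>b. realizes (join x y) t b" if "t \<in> tensor_semiring p" for t
          using tensor_eval_realized[OF x y that] by blast
        show "realizes (join x y) (in_left (d p 0 j)) True" "realizes (join x y) (in_right (d p 0 j)) True"
          using x(2)[OF d_in_Lambda_typ, of 0 j] y(2)[OF d_in_Lambda_typ, of 0 j] ab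
          by (simp_all add: realizes_join x y bounded_degree_d)
      qed (simp_all add: in_left_d in_right_d Delta_d_0[OF p(1)] is_delta_Delta[OF p(1)])
      then have "c (d p i j)"
        using realizes_unique[OF xy_c[OF d_in_Lambda_typ]] by blast
      then show ?thesis
        using ab by (simp add: c_def)
    qed
  qed
qed

text \<open>
  If one of \<open>a\<close> and \<open>b\<close> vanishes on \<open>d\<^sub>1\<^sub>,\<^sub>j\<close> then the values of the \<open>d\<^sub>0\<^sub>,\<^sub>j'\<close> with
  \<open>j' \<ge> j\<close> at points realizing it are powers of a single number, so that in this range
  multiplication by it amounts to a rescaling. If neither does then the image of \<open>d\<^sub>1\<^sub>,\<^sub>j\<close>
  contains the nonzero product of \<open>d\<^sub>1\<^sub>,\<^sub>j \<otimes> 1\<close> and \<open>1 \<otimes> d\<^sub>1\<^sub>,\<^sub>j\<close> with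
  multiplicity \<open>p\<close>, in particular at least twice.
\<close>

lemma witt_mult_in_witt_and_d:
  fixes a b :: "nat mps \<Rightarrow> bool"
  assumes p: "prime p" "p > 2" and a: "a \<in> witt p" and b: "b \<in> witt p"
  shows "witt_mult p a b \<in> witt p"
    and "witt_mult p a b (d p i j) \<longleftrightarrow> (a (d p 1 j) \<and> b (d p 1 j)) \<or>
      (a (d p i j) \<and> b (d p 0 j)) \<or> (a (d p 0 j) \<and> b (d p i j))"
proof -
  obtain x where x: "\<And>N. finitely_supported (x N)" "\<And>f. f \<in> Lambda_typ p \<Longrightarrow> realizes x f (a f)"
    using witt_realization[OF p(1) a] by blast
  obtain y where y: "\<And>N. finitely_supported (y N)" "\<And>f. f \<in> Lambda_typ p \<Longrightarrow> realizes y f (b f)"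
    using witt_realization[OF p(1) b] by blast
  have p0: "p > 0"
    using p by simp
  define c where "c = witt_mult p a b"
  define z where "z = (\<lambda>N n. \<Prod>k\<in>#pair_monomial n. join x y N k)"
  have xy: "finitely_supported (join x y N)" for N
    by (intro finitely_supported_join x y)
  have z: "finitely_supported (z N)" for N
    unfolding z_def by (rule value_at_Delta_times(2)[OF xy bounded_degree_zero])
  have xy_c: "realizes (join x y) (Delta_times f) (c f)" if "f \<in> Lambda_typ p" for f
    using tensor_eval_realized[OF x y Delta_in_tensor_semiring(2)[OF p(1) that]] that
    by (simp add: c_def witt_mult_def)
  have z_c: "realizes z f (c f)" if f: "f \<in> Lambda_typ p" for f
    using xy_c[OF f] by (simp add: realizes_def z_def value_at_Delta_times(1)[OF xy bounded_degree_Lambda_typ[OF f]])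
  show "witt_mult p a b \<in> witt p"
    unfolding c_def[symmetric]
  proof (rule witt_by_realization[OF z _ z_c])
    show "c \<in> extensional (Lambda_typ p)"
      by (simp only: c_def witt_mult_def restrict_extensional)
  qed
  have z_0: "value_at (z N) (d p 0 j) = value_at (x N) (d p 0 j) * value_at (y N) (d p 0 j)" for N j
    unfolding z_def value_at_Delta_times(1)[OF xy bounded_degree_d, symmetric] Delta_d_0(2)[OF p(1)]
    by (simp add: value_at_mult xy bounded_degree_in_left bounded_degree_in_right bounded_degree_d
        value_at_join x y)
  have powers: "\<forall>\<^sub>F N in sequentially. value_at (w N) (d p 0 j') = value_at (w N) (d p 0 j) ^ (p ^ (j' - j))"
    if "e \<in> witt p" "\<not> e (d p 1 j)" "j \<le> j'" "\<And>f. f \<in> Lambda_typ p \<Longrightarrow> realizes w f (e f)"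
      "\<And>N. finitely_supported (w N)"
    for w :: "nat \<Rightarrow> nat \<Rightarrow> complex" and e j'
    using that(3)
  proof (induction rule: dec_induct)
    case base
    show ?case
      by simp
  next
    case (step k)
    have "\<not> e (d p 1 k)"
      using witt_antimono[OF p(1) that(1), of 1 k 1 j] that(2) step by auto
    then have "\<forall>\<^sub>F N in sequentially. value_at (w N) (d p (Suc 0) k) = 0"
      using that(4)[OF d_in_Lambda_typ, of 1 k] unfolding realizes_def by (auto elim: eventually_mono)
    with step.IH show ?case
    proof eventually_elim
      case (elim N)
      then have "value_at (w N) (d p 0 (Suc k)) = value_at (w N) (d p 0 k) ^ p"
        using p0 by (simp add: value_at_d_Suc[OF p(1) that(5)])
      then show ?case
        using elim step.hyps by (simp add: Suc_diff_le mult.commute flip: power_mult)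
    qed
  qed
  have nonzero: "\<forall>\<^sub>F N in sequentially. value_at (w N) (d p 0 j) \<noteq> 0 \<longleftrightarrow> e (d p 0 j)"
    if "\<And>f. f \<in> Lambda_typ p \<Longrightarrow> realizes w f (e f)" for w :: "nat \<Rightarrow> nat \<Rightarrow> complex" and e
    using that[OF d_in_Lambda_typ, of 0 j] unfolding realizes_def by (auto elim: eventually_mono)
  show "witt_mult p a b (d p i j) \<longleftrightarrow> (a (d p 1 j) \<and> b (d p 1 j)) \<or>
      (a (d p i j) \<and> b (d p 0 j)) \<or> (a (d p 0 j) \<and> b (d p i j))"
  proof -
    have zero: "e (d p i j) \<Longrightarrow> e (d p 0 j)" "e (d p i j) \<Longrightarrow> i \<noteq> 0 \<Longrightarrow> e (d p 1 j)"
        "e (d p 1 j) \<Longrightarrow> e (d p 0 j)" if "e \<in> witt p" for e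
      using witt_antimono[OF p(1) that, of i j 0 j] witt_antimono[OF p(1) that, of i j 1 j]
        witt_antimono[OF p(1) that, of 1 j 0 j] by auto
    consider (b) "\<not> b (d p 1 j)" | (a) "\<not> a (d p 1 j)" | (ab) "a (d p 1 j)" "b (d p 1 j)"
      by blast
    then show ?thesis
    proof cases
      case b
      have "c (d p i j) \<longleftrightarrow> a (d p i j) \<and> b (d p 0 j)"
      proof (rule realizes_d_scaled[OF p(1) x(1) z, where i = i and \<rho> = "\<lambda>N. value_at (y N) (d p 0 j)"])
        show "\<forall>\<^sub>F N in sequentially. value_at (z N) (d p 0 j') =
            value_at (x N) (d p 0 j') * value_at (y N) (d p 0 j) ^ (p ^ (j' - j))" if "j' \<ge> j" for j'
        proof -
          have "\<forall>\<^sub>F N in sequentially.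
              value_at (y N) (d p 0 j') = value_at (y N) (d p 0 j) ^ (p ^ (j' - j))"
            by (rule powers[OF \<open>b \<in> witt p\<close> b that y(2,1)])
          then show ?thesis
            by eventually_elim (simp add: z_0)
        qed
      qed (simp_all add: x(2) z_c d_in_Lambda_typ nonzero[OF y(2)])
      then show ?thesis
        using b zero[OF \<open>b \<in> witt p\<close>] zero[OF \<open>a \<in> witt p\<close>] by (cases "i = 0") (auto simp: c_def)
    next
      case a
      have "c (d p i j) \<longleftrightarrow> b (d p i j) \<and> a (d p 0 j)"
      proof (rule realizes_d_scaled[OF p(1) y(1) z, where i = i and \<rho> = "\<lambda>N. value_at (x N) (d p 0 j)"])
        show "\<forall>\<^sub>F N in sequentially. value_at (z N) (d p 0 j') =
            value_at (y N) (d p 0 j') * value_at (x N) (d p 0 j) ^ (p ^ (j' - j))" if "j' \<ge> j" for j'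
        proof -
          have "\<forall>\<^sub>F N in sequentially.
              value_at (x N) (d p 0 j') = value_at (x N) (d p 0 j) ^ (p ^ (j' - j))"
            by (rule powers[OF \<open>a \<in> witt p\<close> a that x(2,1)])
          then show ?thesis
            by eventually_elim (simp add: z_0)
        qed
      qed (simp_all add: y(2) z_c d_in_Lambda_typ nonzero[OF x(2)])
      then show ?thesis
        using a zero[OF \<open>b \<in> witt p\<close>] zero[OF \<open>a \<in> witt p\<close>] by (cases "i = 0") (auto simp: c_def)
    next
      case ab
      note bdl = bounded_degree_in_left[OF bounded_degree_d] and bdr = bounded_degree_in_right[OF bounded_degree_d]
      have R: "\<exists>b. realizes (join x y) t b" if "t \<in> tensor_semiring p" for t
        using tensor_eval_realized[OF x y that] by blast
      have left: "realizes (join x y) (in_left (d p i j)) (a (d p i j))"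
        and right: "realizes (join x y) (in_right (d p i j)) (b (d p i j))" for i
        by (simp_all add: realizes_join x y bounded_degree_d d_in_Lambda_typ)
      have "realizes (join x y) (Delta_times (d p i j)) True"
      proof (cases i)
        case 0
        show ?thesis
          using realizes_mult[OF left[of 0] right[of 0] bdl bdr xy]
            zero(3)[OF \<open>a \<in> witt p\<close>] zero(3)[OF \<open>b \<in> witt p\<close>] ab
          by (simp add: 0 Delta_d_0[OF p(1)])
      next
        case (Suc i')
        (* In the image p h + r of d 1 j, the terms h and (p - 1) h + r are the two nonzero ones. *)
        define h where "h = in_left (d p 1 j) * in_right (d p 1 j)"
        define r where "r = in_left (d p 1 j) * in_right (d p 0 (Suc j)) +
          in_left (d p 0 (Suc j)) * in_right (d p 1 j)"
        define g where "g = of_nat (p - 1) * h"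
        have T: "h \<in> tensor_semiring p" "r \<in> tensor_semiring p" "g \<in> tensor_semiring p"
          unfolding h_def r_def g_def
          by (intro subsemiring_generated.add subsemiring_generated.mult in_left_d in_right_d generated_of_nat)+
        have h: "realizes (join x y) h True"
          using realizes_mult[OF left[of 1] right[of 1] bdl bdr xy] ab by (simp add: h_def)
        have g: "realizes (join x y) g True"
          using realizes_mult[OF realizes_of_nat[OF xy, where n = "p - 1"] h bounded_degree_of_nat
              bounded_degree_tensor_semiring[OF T(1)] xy] p(2) by (simp add: g_def)
        obtain e where e: "realizes (join x y) r e"
          using R[OF T(2)] by blast
        have gr: "realizes (join x y) (g + r) True"
          using realizes_add[OF g e bounded_degree_tensor_semiring[OF T(3)]
              bounded_degree_tensor_semiring[OF T(2)] xy] by simp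
        have "is_delta p (Delta_times (d p 0 j)) (of_nat p * h + in_left (d p 1 j) * frob p (in_right (d p 0 j)) +
            frob p (in_left (d p 0 j)) * in_right (d p 1 j))"
          unfolding Delta_d_0(2)[OF p(1)] h_def One_nat_def
          by (intro is_delta_mult p0 bdl bdr is_delta_in_left is_delta_in_right is_delta_d p bounded_degree_d)
        then have "Delta_times (d p (Suc 0) j) = of_nat p * h + r"
          using is_delta_unique[OF is_delta_Delta(2)[OF p(1), of 0 j] _ p0]
          by (simp add: r_def frob_in_left frob_in_right p0 bounded_degree_d frob_d[OF p(1)] add.assoc)
        also have "of_nat p * h = h + g"
          using p0 unfolding g_def
          by (metis (no_types) Suc_diff_1 mult.left_neutral distrib_right of_nat_Suc)
        finally have "Delta_times (d p (Suc 0) j) = h + (g + r)"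
          by (simp add: add.assoc)
        then show ?thesis
          unfolding Suc
          by (intro is_delta_two_terms_iterate[OF p xy R T(1) h subsemiring_generated.add[OF T(3,2)] gr,
              where s = "\<lambda>i. Delta_times (d p (Suc i) j)"] is_delta_Delta[OF p(1)]) auto
      qed
      then have "c (d p i j)"
        using realizes_unique[OF xy_c[OF d_in_Lambda_typ]] by blast
      then show ?thesis
        using ab by (simp add: c_def)
    qed
  qed
qed

lemma coeff_empty_msubst:
  assumes y: "\<And>i. y i = None \<or> y i = Some {#}"
  shows "of_int (coeff (msubst y f) {#}) = value_at (\<lambda>i. of_bool (y i = Some {#})) f"
proof -
  have "monomial_subst y a = Some {#} \<longleftrightarrow> (\<forall>i\<in>#a. y i = Some {#})" for a
    using y by (force simp: monomial_subst_def)
  moreover have "(\<Prod>i\<in>#a. of_bool (y i = Some {#})) = (of_bool (\<forall>i\<in>#a. y i = Some {#}) :: complex)" for a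
    by (induction a) auto
  ultimately show ?thesis
    unfolding coeff_msubst value_at_def linear_ext_def by simp
qed

text \<open>Zero and one are realized by the constant sequences of points \<open>(0, 0, \<dots>)\<close> and \<open>(1, 0, \<dots>)\<close>.\<close>

lemma realizes_coeff_empty_msubst:
  assumes y: "\<And>i. y i = None \<or> y i = Some {#}" and f: "f \<in> Lambda_typ p"
  shows "realizes (\<lambda>_ i. of_bool (y i = Some {#})) f (of_nat (nat (coeff (msubst y f) {#})))"
proof -
  have "coeff f m \<ge> 0" for m
    using f Lambda_typ_subset_Lambda_N Lambda_N_E by blast
  then have nonneg: "coeff (msubst y f) {#} \<ge> 0"
    by (auto simp: msubst_def intro: sum_nonneg)
  have "(of_nat n :: bool) \<longleftrightarrow> n > 0" for n
    by (induction n) (auto simp: zero_bool_def one_bool_def plus_bool_def)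
  moreover obtain n where n: "coeff (msubst y f) {#} = int n"
    using nonneg nonneg_int_cases by blast
  moreover have "value_at (\<lambda>i. of_bool (y i = Some {#})) f = of_nat n"
    using coeff_empty_msubst[of y f, OF y] n by simp
  ultimately show ?thesis
    by (simp add: realizes_def)
qed

lemma witt_zero_in_witt_and_d:
  assumes p: "prime p"
  shows "(witt_zero p :: nat mps \<Rightarrow> bool) \<in> witt p" and "\<not> witt_zero p (d p i j)"
proof -
  let ?x = "\<lambda>_ :: nat. 0 :: complex"
  have fin: "finitely_supported ?x"
    by (simp add: finitely_supported_def)
  have r: "realizes (\<lambda>_. ?x) f (witt_zero p f)" if "f \<in> Lambda_typ p" for f
    using realizes_coeff_empty_msubst[of "\<lambda>_. None", OF _ that] that by (simp add: witt_zero_def)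
  show "(witt_zero p :: nat mps \<Rightarrow> bool) \<in> witt p"
  proof (rule witt_by_realization[where x = "\<lambda>_. ?x", OF fin _ r])
    show "(witt_zero p :: nat mps \<Rightarrow> bool) \<in> extensional (Lambda_typ p)"
      by (simp only: witt_zero_def restrict_extensional)
  qed
  have "value_at ?x (d p i j) = 0" for j
  proof (induction i arbitrary: j)
    case 0
    show ?case
      using value_at_power_sum[OF fin, of "p ^ j"] prime_gt_0_nat[OF p] by (simp add: d_0)
  next
    case (Suc i)
    then show ?case
      using prime_gt_0_nat[OF p] by (simp add: value_at_d_Suc[OF p fin] zero_power)
  qed
  then show "\<not> witt_zero p (d p i j)"
    using r[OF d_in_Lambda_typ, of i j] by (simp add: realizes_def)
qed

lemma witt_one_in_witt_and_d:
  assumes p: "prime p"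
  shows "(witt_one p :: nat mps \<Rightarrow> bool) \<in> witt p" and "witt_one p (d p i j) \<longleftrightarrow> i = 0"
proof -
  let ?y = "\<lambda>i :: nat. if i = 0 then Some ({#} :: nat multiset) else None"
  let ?x = "\<lambda>i. of_bool (?y i = Some {#}) :: complex"
  have supp: "{i. ?x i \<noteq> 0} = {0}"
    by auto
  then have fin: "finitely_supported ?x"
    unfolding finitely_supported_def by (simp only: supp) simp
  have r: "realizes (\<lambda>_. ?x) f (witt_one p f)" if "f \<in> Lambda_typ p" for f
    using realizes_coeff_empty_msubst[of ?y, OF _ that] that by (simp add: witt_one_def)
  show "(witt_one p :: nat mps \<Rightarrow> bool) \<in> witt p"
  proof (rule witt_by_realization[where x = "\<lambda>_. ?x", OF fin _ r])
    show "(witt_one p :: nat mps \<Rightarrow> bool) \<in> extensional (Lambda_typ p)"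
      by (simp only: witt_one_def restrict_extensional)
  qed
  have "value_at ?x (d p i j) = of_bool (i = 0)" for j
  proof (induction i arbitrary: j)
    case 0
    have "value_at ?x (power_sum (p ^ j)) = (\<Sum>i\<in>{0}. ?x i ^ (p ^ j))"
      using prime_gt_0_nat[OF p] by (subst value_at_power_sum[OF fin]) (simp_all only: supp zero_less_power)
    then show ?case
      using prime_gt_0_nat[OF p] by (simp add: d_0)
  next
    case (Suc i)
    show ?case
      unfolding value_at_d_Suc[OF p fin] Suc using prime_gt_0_nat[OF p] by (simp add: zero_power)
  qed
  then show "witt_one p (d p i j) \<longleftrightarrow> i = 0"
    using r[OF d_in_Lambda_typ, of i j] by (simp add: realizes_def)
qed

text \<open>
  The following operations are read off from the formulas for the values of sums and products on
  the \<open>d\<^sub>i\<^sub>,\<^sub>j\<close>, in which \<open>p\<close> does not occur.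
\<close>

fun nat2_plus :: "nat2_top \<Rightarrow> nat2_top \<Rightarrow> nat2_top" where
  "nat2_plus (Pair_nat x y) (Pair_nat x' y') =
     (if x = 0 \<or> x' = 0 then Pair_nat (max x x') (max y y') else Infty)"
| "nat2_plus _ _ = Infty"

fun nat2_times :: "nat2_top \<Rightarrow> nat2_top \<Rightarrow> nat2_top" where
  "nat2_times (Pair_nat x y) (Pair_nat x' y') =
     (if x = 0 \<and> x' = 0 then Pair_nat 0 (min y y')
      else if x = 0 then Pair_nat 0 y
      else if x' = 0 then Pair_nat 0 y'
      else if x = 1 \<or> x' = 1 then Pair_nat (max x x') (max y y')
      else Infty)"
| "nat2_times (Pair_nat x y) Infty = (if x = 0 then Pair_nat 0 y else Infty)"
| "nat2_times Infty (Pair_nat x y) = (if x = 0 then Pair_nat 0 y else Infty)"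
| "nat2_times Infty Infty = Infty"

lemma pattern_nat2_plus:
  "pattern (nat2_plus u v) i j \<longleftrightarrow> pattern u i j \<or> pattern v i j \<or> (pattern u 0 j \<and> pattern v 0 j)"
  by (cases u; cases v) auto

lemma pattern_nat2_times:
  "pattern (nat2_times u v) i j \<longleftrightarrow> (pattern u 1 j \<and> pattern v 1 j) \<or>
    (pattern u i j \<and> pattern v 0 j) \<or> (pattern u 0 j \<and> pattern v i j)"
  by (cases u; cases v) auto

lemma boolean_witt_plus:
  assumes "prime p" "p > 2"
  shows "boolean_witt p (nat2_plus u v) = witt_add p (boolean_witt p u) (boolean_witt p v)"
  using witt_add_in_witt_and_d[OF assms boolean_witt_in_witt boolean_witt_in_witt] assms(1)
  by (intro boolean_witt_eqI) (simp_all add: boolean_witt_d pattern_nat2_plus)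

lemma boolean_witt_times:
  assumes "prime p" "p > 2"
  shows "boolean_witt p (nat2_times u v) = witt_mult p (boolean_witt p u) (boolean_witt p v)"
  using witt_mult_in_witt_and_d[OF assms boolean_witt_in_witt boolean_witt_in_witt] assms(1)
  by (intro boolean_witt_eqI) (simp_all add: boolean_witt_d pattern_nat2_times)

lemma boolean_witt_zero: "prime p \<Longrightarrow> boolean_witt p (Pair_nat 0 0) = witt_zero p"
  by (intro boolean_witt_eqI) (simp_all add: witt_zero_in_witt_and_d)

lemma boolean_witt_one: "prime p \<Longrightarrow> boolean_witt p (Pair_nat 1 0) = witt_one p"
  by (intro boolean_witt_eqI) (simp_all add: witt_one_in_witt_and_d)

theorem theorem1p4:
  shows "(\<forall>p. prime (p::nat) \<longrightarrow>
            (\<forall>u. \<exists>!a. a \<in> witt p \<and> corresponds p u a) \<and>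
            bij_betw (boolean_witt p) UNIV (witt p) \<and>
            (\<forall>u v. u \<le> v \<longleftrightarrow> witt_le p (boolean_witt p u) (boolean_witt p v))) \<and>
         (\<exists>plus times zero one. \<forall>p. prime (p::nat) \<and> p > 2 \<longrightarrow>
            (\<forall>u v. boolean_witt p (plus u v) = witt_add p (boolean_witt p u) (boolean_witt p v)) \<and>
            (\<forall>u v. boolean_witt p (times u v) = witt_mult p (boolean_witt p u) (boolean_witt p v)) \<and>
            boolean_witt p zero = witt_zero p \<and>
            boolean_witt p one = witt_one p)"
proof (intro conjI allI impI)
  fix p :: nat assume p: "prime p"
  show "\<exists>!a. a \<in> witt p \<and> corresponds p u a" for u
    by (rule ex1_corresponds[OF p])
  show "bij_betw (boolean_witt p) UNIV (witt p)"
    by (rule bij_betw_boolean_witt[OF p])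
  show "u \<le> v \<longleftrightarrow> witt_le p (boolean_witt p u) (boolean_witt p v)" for u v
    by (simp add: boolean_witt_le_iff[OF p])
next
  show "\<exists>plus times zero one. \<forall>p. prime (p::nat) \<and> p > 2 \<longrightarrow>
      (\<forall>u v. boolean_witt p (plus u v) = witt_add p (boolean_witt p u) (boolean_witt p v)) \<and>
      (\<forall>u v. boolean_witt p (times u v) = witt_mult p (boolean_witt p u) (boolean_witt p v)) \<and>
      boolean_witt p zero = witt_zero p \<and> boolean_witt p one = witt_one p"
    by (intro exI[of _ nat2_plus] exI[of _ nat2_times] exI[of _ "Pair_nat 0 0"] exI[of _ "Pair_nat 1 0"])
      (simp add: boolean_witt_plus boolean_witt_times boolean_witt_zero boolean_witt_one[unfolded One_nat_def])
qed

end
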